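(* Fix constants $\delta,\lambda>0$ and let $2+\varepsilon=(2+3/\lambda)(1+\delta)$. Consider any execution of the concurrent parallel level data structure (CPLDS) algorithm specified in the context, and any read of a vertex $v$ in it that returns a value $\hat k$. Then the level of $v$ from which $\hat k$ was computed is the level of $v$ at some point in time between two consecutive update batches (i.e. the level at the beginning or at the end of a batch, never an intermediate level). Moreover, $\hat k$ is a $(2+\varepsilon)$-approximation of the true coreness $k(v)$ of $v$ in the graph $G$ at that point in time between update batches: if $k(v)\ge 1$, then $$\frac{k(v)}{2+\varepsilon}\le \hat k\le (2+\varepsilon)\,k(v).$$
   Context: **Coreness.** For a graph $G$ and positive integer $k$, the $k$-core of $G$ is the maximal subgraph with minimum induced degree $k$; the coreness $k(v)$ is the $k$ such that $v$ belongs to a $k$-core but not to a $(k+1)$-core. **Model.** $G$ is an undirected, unweighted graph on vertex set $\{0,\dots,n-1\}$ whose edges change over time. Processes communicate through shared memory and are partitioned into update processes and read processes. Update processes are synchronous (computation and communication delays are bounded by a known constant). Read processes are asynchronous (arbitrarily delayed). No process fails. Updates (edge insertions/deletions) arrive in batches, one batch executed after another; each batch $\mathcal B$ contains only insertions or only deletions, and all update processes collectively execute each batch in parallel. A read of a vertex $v$ is executed by a single read process, concurrently with batches and other reads. **Level data structure (LDS).** Vertices are partitioned into $K=O(\log^2 n)$ levels $0,\dots,K-1$, partitioned into groups $g_0,\dots,g_{\lceil\log_{1+\delta} n\rceil}$ of $4\lceil\log_{1+\delta}n\rceil$ contiguous levels each. Let $\ell(v)$ be the (live) level of $v$, and $Z_\ell$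 the set of vertices at levels $\ge \ell$. Invariant 1: if $\ell(v)=\ell<K$ and $\ell\in g_i$, then $v$ has at most $(2+3/\lambda)(1+\delta)^i$ neighbors in $Z_\ell$. Invariant 2: if $\ell(v)=\ell>0$ and $\ell-1\in g_i$, then $v$ has at least $(1+\delta)^i$ neighbors in $Z_{\ell-1}$. Between batches, all vertices satisfy both invariants. The coreness estimate computed from level $\ell(v)$ is $\hat k(v)=(1+\delta)^{\max(\lfloor(\ell(v)+1)/(4\lceil\log_{1+\delta}n\rceil)\rfloor-1,\,0)}$. **Global state.** An integer `batch_number`, incremented at the start of every batch, and an array `desc_array` with one descriptor per vertex. A descriptor is either the special value UNMARKED, or marked, in which case it has a field `parent` (the index of the vertex's parent in its dependency DAG, or the special value I_AM_ROOT) and a field `old_level`. A vertex is marked iff its entry of `desc_array` is marked. **Execution of a batch $\mathcal B$.** First all edges of $\mathcal B$ are inserted into (or deleted from) $G$. Then the levels are visited in increasing order, the vertices of a level being processed in parallel. For an insertion batch, each vertex of the current level violating Invariant 1 is moved up one level; each level is visited at most once. For a deletion batch, each vertex violating Invariant 2 computes its desire level (the highest level below its current one at which it satisfies Invariant 2); when level $\ell$ is visited, all vertices with desire level $\ell$ move there and their neighbors at higher levels recompute their desire levels; a vertex moves at most once. Before a vertex $v$ moves for the first time in the batch, `mark(v, triggers)` is executed. For insertions, the triggers are the marked neighbors of $v$ at the same or a higher level than $v$ (a vertex which was at a lower level than $v$ earlier in the batch but moved above $v$ may become a trigger later). For deletions, they are the marked neighbors of $v$ at levels lower than $\ell(v)-1$.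 After all levels have been visited, `unmark_all` is executed and the batch ends. `mark(v, triggers)`: create a new descriptor for $v$ with `old_level` equal to the current level of $v$; let `marked_batch_neighbors` be the set of $w$ such that edge $(v,w)$ belongs to $\mathcal B$ and $w$ is already marked; for every $w$ in `marked_batch_neighbors` or `triggers` perform `union(v,w)`; write the descriptor to `desc_array[v]`. Here `union` is the (linearizable) union operation of a concurrent union-find structure whose parent pointers are the `parent` fields: it merges the two dependency DAGs, one root being deterministically chosen as the single root of the merged DAG. The dependency DAGs of the batch are the resulting trees; each has a single root, reached from any member by following `parent` pointers. Traversals may compress paths (redirecting `parent` fields of traversed vertices to the root). The following is maintained: in each DAG the root descriptor is marked before non-root descriptors of the same DAG are marked, and is unmarked before they are unmarked. `unmark_all`: in parallel, set to UNMARKED all marked descriptors with `parent` $=$ I_AM_ROOT; after that, in parallel, set to UNMARKED all remaining marked descriptors. **Read algorithm.** `read(v)`: (1) $b_1:=$ `batch_number`; (2) $l_1:=$ live level of $v$; (3) `desc` $:=$ `desc_array[v]`; (4) `status` $:=$ `check_DAG(desc)`; (5) $l_2:=$ live level of $v$; (6) $b_2:=$ `batch_number`. If $b_1\ne b_2$, restart from (1). Otherwise, if `status` is MARKED, return the coreness estimate computed from `desc.old_level`. Otherwise, if $l_1=l_2$, return the coreness estimate computed from $l_1$, and if $l_1\neq l_2$, restart from (1). `check_DAG(desc)`: if `desc` is UNMARKED return UNMARKED; while `desc.parent` $\ne$ I_AM_ROOT, replace `desc` by the descriptor of the parent vertex and return UNMARKED if it is UNMARKED; when the root is reached return MARKED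 if it is marked and UNMARKED otherwise. *)

theory Defs
  imports Complex_Main
begin

section \<open>Graphs and coreness\<close>

text \<open>Graphs have vertex set \<open>{..<n}\<close> and are given by their set of edges \<open>{u, w}\<close>, \<open>u \<noteq> w\<close>.\<close>

definition all_edges :: "nat \<Rightarrow> nat set set" where
  "all_edges n = {{u, w} | u w. u < n \<and> w < n \<and> u \<noteq> w}"

definition min_induced_degree_ge :: "nat set set \<Rightarrow> nat \<Rightarrow> nat set \<Rightarrow> bool" where
  "min_induced_degree_ge E k S \<longleftrightarrow> (\<forall>v\<in>S. k \<le> card {w \<in> S. {v, w} \<in> E})"

text \<open>A maximal subgraph with given minimum degree is an induced one, so a core is represented by
  its vertex set.\<close>

definition is_core :: "nat \<Rightarrow> nat set set \<Rightarrow> nat \<Rightarrow> nat set \<Rightarrow> bool" where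
  "is_core n E k S \<longleftrightarrow> S \<subseteq> {..<n} \<and> min_induced_degree_ge E k S \<and>
     (\<forall>T. S \<subseteq> T \<and> T \<subseteq> {..<n} \<and> min_induced_degree_ge E k T \<longrightarrow> T = S)"

text \<open>Every vertex lies in the 0-core, so vertices outside the 1-core have coreness 0.\<close>

definition coreness :: "nat \<Rightarrow> nat set set \<Rightarrow> nat \<Rightarrow> nat" where
  "coreness n E v = (THE k. (\<exists>S. is_core n E k S \<and> v \<in> S) \<and> \<not> (\<exists>S. is_core n E (Suc k) S \<and> v \<in> S))"


section \<open>The level data structure\<close>

text \<open>There are \<open>ceil_log n \<delta> + 1\<close> groups.  For \<open>n = 1\<close> there are no levels at all, so that the
  structure (and hence an execution) only exists for \<open>n \<noteq> 1\<close>.\<close>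

definition ceil_log :: "nat \<Rightarrow> real \<Rightarrow> nat" where
  "ceil_log n \<delta> = nat \<lceil>log (1 + \<delta>) (real n)\<rceil>"

definition group_size :: "nat \<Rightarrow> real \<Rightarrow> nat" where
  "group_size n \<delta> = 4 * ceil_log n \<delta>"

definition num_levels :: "nat \<Rightarrow> real \<Rightarrow> nat" where
  "num_levels n \<delta> = (ceil_log n \<delta> + 1) * group_size n \<delta>"

definition group_of :: "nat \<Rightarrow> real \<Rightarrow> nat \<Rightarrow> nat" where
  "group_of n \<delta> l = l div group_size n \<delta>"

text \<open>Truncated subtraction on \<open>nat\<close> realises the maximum with 0 in the exponent.\<close>

definition estimate :: "nat \<Rightarrow> real \<Rightarrow> nat \<Rightarrow> real" where
  "estimate n \<delta> l = (1 + \<delta>) ^ ((l + 1) div group_size n \<delta> - 1)"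

definition nbrs_from :: "nat set set \<Rightarrow> (nat \<Rightarrow> nat) \<Rightarrow> nat \<Rightarrow> nat \<Rightarrow> nat set" where
  "nbrs_from E lev v l = {w. {v, w} \<in> E \<and> l \<le> lev w}"

text \<open>The invariants for \<open>v\<close> if it were placed at level \<open>l\<close>, the other vertices being at the levels
  given by \<open>lev\<close>; as \<open>v\<close> is not its own neighbour, \<open>lev v\<close> does not matter.\<close>

definition inv1_at :: "nat \<Rightarrow> real \<Rightarrow> real \<Rightarrow> nat set set \<Rightarrow> (nat \<Rightarrow> nat) \<Rightarrow> nat \<Rightarrow> nat \<Rightarrow> bool" where
  "inv1_at n \<delta> lam E lev v l \<longleftrightarrow> (l < num_levels n \<delta> \<longrightarrow>
     real (card (nbrs_from E lev v l)) \<le> (2 + 3 / lam) * (1 + \<delta>) ^ group_of n \<delta> l)"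

definition inv2_at :: "nat \<Rightarrow> real \<Rightarrow> nat set set \<Rightarrow> (nat \<Rightarrow> nat) \<Rightarrow> nat \<Rightarrow> nat \<Rightarrow> bool" where
  "inv2_at n \<delta> E lev v l \<longleftrightarrow> (l > 0 \<longrightarrow>
     (1 + \<delta>) ^ group_of n \<delta> (l - 1) \<le> real (card (nbrs_from E lev v (l - 1))))"

definition desire_level :: "nat \<Rightarrow> real \<Rightarrow> nat set set \<Rightarrow> (nat \<Rightarrow> nat) \<Rightarrow> nat \<Rightarrow> nat option" where
  "desire_level n \<delta> E lev v =
     (if inv2_at n \<delta> E lev v (lev v) then None
      else Some (Max {l. l < lev v \<and> inv2_at n \<delta> E lev v l}))"


section \<open>Global state\<close>

datatype parent_field = I_AM_ROOT | Parent nat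

datatype descriptor = UNMARKED | Marked (parent: parent_field) (old_level: nat)

datatype kind = Insertion | Deletion

type_synonym batch = "kind \<times> nat set set"

text \<open>\<open>Between\<close>: no batch is being executed.  \<open>Edges b\<close>: the batch \<open>b\<close> has started, its edges are not
  yet applied to the graph.  \<open>Desires b\<close>: (deletions only) the initial desire levels are being
  computed.  \<open>Visit b l\<close>: level \<open>l\<close> is being visited.  \<open>Unmark_Roots\<close> and \<open>Unmark_Rest\<close>: the two
  rounds of \<open>unmark_all\<close>.\<close>

datatype phase =
    Between | Edges batch | Desires batch | Visit batch nat | Unmark_Roots | Unmark_Rest

text \<open>What is being done for a vertex \<open>v\<close> of the visited level.  \<open>Marking A W\<close>: \<open>v\<close> is executing
  \<open>mark\<close>, the vertices in \<open>A\<close> have not yet been inspected for being marked batch neighbours or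
  triggers, and \<open>union(v, w)\<close> is still to be performed for the \<open>w \<in> W\<close>.  \<open>Moving\<close>: \<open>v\<close> is marked
  and is about to change its level.\<close>

datatype vertex_task = Idle | Marking "nat set" "nat set" | Moving

text \<open>\<open>new_desc v\<close> is the descriptor created by a running \<open>mark\<close> of \<open>v\<close> and not yet written to
  \<open>desc_array\<close>.  \<open>recompute\<close> is the set of vertices that still have to (re)compute their desire
  level.\<close>

record config =
  graph :: "nat set set"
  level :: "nat \<Rightarrow> nat"
  batch_number :: nat
  desc_array :: "nat \<Rightarrow> descriptor"
  phase :: phase
  task :: "nat \<Rightarrow> vertex_task"
  new_desc :: "nat \<Rightarrow> descriptor option"
  desire :: "nat \<Rightarrow> nat option"
  recompute :: "nat set"

definition marked :: "config \<Rightarrow> nat \<Rightarrow> bool" where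
  "marked s v \<longleftrightarrow> desc_array s v \<noteq> UNMARKED"

definition initial :: "nat \<Rightarrow> real \<Rightarrow> real \<Rightarrow> config \<Rightarrow> bool" where
  "initial n \<delta> lam s \<longleftrightarrow>
     graph s \<subseteq> all_edges n \<and>
     (\<forall>v<n. level s v < num_levels n \<delta> \<and>
        inv1_at n \<delta> lam (graph s) (level s) v (level s v) \<and>
        inv2_at n \<delta> (graph s) (level s) v (level s v)) \<and>
     batch_number s = 0 \<and>
     (\<forall>v. desc_array s v = UNMARKED \<and> task s v = Idle \<and> new_desc s v = None \<and> desire s v = None) \<and>
     recompute s = {} \<and> phase s = Between"


section \<open>Dependency DAGs\<close>

text \<open>The DAGs comprise the descriptors under construction: \<open>union(v, w)\<close> is performed before the
  descriptor of \<open>v\<close> is written to \<open>desc_array\<close>.\<close>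

definition cur_desc :: "config \<Rightarrow> nat \<Rightarrow> descriptor" where
  "cur_desc s v = (case new_desc s v of Some d \<Rightarrow> d | None \<Rightarrow> desc_array s v)"

definition parent_rel :: "config \<Rightarrow> (nat \<times> nat) set" where
  "parent_rel s = {(u, p). \<exists>ol. cur_desc s u = Marked (Parent p) ol}"

definition is_root :: "config \<Rightarrow> nat \<Rightarrow> bool" where
  "is_root s r \<longleftrightarrow> (\<exists>ol. cur_desc s r = Marked I_AM_ROOT ol)"

definition root_of :: "config \<Rightarrow> nat \<Rightarrow> nat \<Rightarrow> bool" where
  "root_of s u r \<longleftrightarrow> (u, r) \<in> (parent_rel s)\<^sup>* \<and> is_root s r"

fun with_parent :: "nat \<Rightarrow> descriptor \<Rightarrow> descriptor" where
  "with_parent p UNMARKED = UNMARKED"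
| "with_parent p (Marked q ol) = Marked (Parent p) ol"

definition redirect :: "nat \<Rightarrow> nat \<Rightarrow> config \<Rightarrow> config" where
  "redirect u p s =
     (case new_desc s u of
        Some d \<Rightarrow> s\<lparr>new_desc := (new_desc s)(u := Some (with_parent p d))\<rparr>
      | None \<Rightarrow> s\<lparr>desc_array := (desc_array s)(u := with_parent p (desc_array s u))\<rparr>)"

text \<open>Merging the DAGs with roots \<open>r1\<close>, \<open>r2\<close>.  The deterministic choice of the new root is a function
  \<open>pick\<close> of the state and the two roots.\<close>

definition link :: "(config \<Rightarrow> nat \<Rightarrow> nat \<Rightarrow> nat) \<Rightarrow> nat \<Rightarrow> nat \<Rightarrow> config \<Rightarrow> config" where
  "link pick r1 r2 s =
     (if r1 = r2 then s
      else if pick s r1 r2 = r1 then redirect r2 r1 s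
      else redirect r1 r2 s)"


section \<open>Update processes\<close>

fun apply_edges :: "batch \<Rightarrow> nat set set \<Rightarrow> nat set set" where
  "apply_edges (Insertion, B) E = E \<union> B"
| "apply_edges (Deletion, B) E = E - B"

fun must_move :: "nat \<Rightarrow> real \<Rightarrow> real \<Rightarrow> kind \<Rightarrow> nat \<Rightarrow> config \<Rightarrow> nat \<Rightarrow> bool" where
  "must_move n \<delta> lam Insertion l s v \<longleftrightarrow>
     level s v = l \<and> \<not> inv1_at n \<delta> lam (graph s) (level s) v l"
| "must_move n \<delta> lam Deletion l s v \<longleftrightarrow> desire s v = Some l"

fun trigger :: "kind \<Rightarrow> config \<Rightarrow> nat \<Rightarrow> nat \<Rightarrow> bool" where
  "trigger Insertion s v w \<longleftrightarrow> {v, w} \<in> graph s \<and> marked s w \<and> level s v \<le> level s w"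
| "trigger Deletion s v w \<longleftrightarrow> {v, w} \<in> graph s \<and> marked s w \<and> level s w + 1 < level s v"

fun move :: "kind \<Rightarrow> nat \<Rightarrow> nat \<Rightarrow> config \<Rightarrow> config" where
  "move Insertion l v s = s\<lparr>level := (level s)(v := l + 1), task := (task s)(v := Idle)\<rparr>"
| "move Deletion l v s =
     s\<lparr>level := (level s)(v := l), task := (task s)(v := Idle), desire := (desire s)(v := None),
       recompute := recompute s \<union> {w. {v, w} \<in> graph s \<and> l < level s w}\<rparr>"

inductive update_step ::
  "nat \<Rightarrow> real \<Rightarrow> real \<Rightarrow> (config \<Rightarrow> nat \<Rightarrow> nat \<Rightarrow> nat) \<Rightarrow> config \<Rightarrow> config \<Rightarrow> bool"
  for n \<delta> lam pick where
  start_batch: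
    "phase s = Between \<Longrightarrow> B \<subseteq> all_edges n \<Longrightarrow>
     update_step n \<delta> lam pick s
       (s\<lparr>batch_number := batch_number s + 1, phase := Edges (kd, B)\<rparr>)"
| insert_edges:
    "phase s = Edges (Insertion, B) \<Longrightarrow>
     update_step n \<delta> lam pick s
       (s\<lparr>graph := apply_edges (Insertion, B) (graph s), phase := Visit (Insertion, B) 0\<rparr>)"
| delete_edges:
    "phase s = Edges (Deletion, B) \<Longrightarrow>
     update_step n \<delta> lam pick s
       (s\<lparr>graph := apply_edges (Deletion, B) (graph s), recompute := {..<n},
          phase := Desires (Deletion, B)\<rparr>)"
| compute_desire:
    "phase s = Desires b \<or> phase s = Visit b l \<Longrightarrow> v \<in> recompute s \<Longrightarrow>
     update_step n \<delta> lam pick s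
       (s\<lparr>desire := (desire s)(v := desire_level n \<delta> (graph s) (level s) v),
          recompute := recompute s - {v}\<rparr>)"
| desires_done:
    "phase s = Desires b \<Longrightarrow> recompute s = {} \<Longrightarrow>
     update_step n \<delta> lam pick s (s\<lparr>phase := Visit b 0\<rparr>)"
| begin_mark:
    "phase s = Visit (kd, B) l \<Longrightarrow> v < n \<Longrightarrow> task s v = Idle \<Longrightarrow> must_move n \<delta> lam kd l s v \<Longrightarrow>
     \<not> marked s v \<Longrightarrow>
     update_step n \<delta> lam pick s
       (s\<lparr>new_desc := (new_desc s)(v := Some (Marked I_AM_ROOT (level s v))),
          task := (task s)(v := Marking {..<n} {})\<rparr>)"
| skip_mark:
    "phase s = Visit (kd, B) l \<Longrightarrow> v < n \<Longrightarrow> task s v = Idle \<Longrightarrow> must_move n \<delta> lam kd l s v \<Longrightarrow>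
     marked s v \<Longrightarrow>
     update_step n \<delta> lam pick s (s\<lparr>task := (task s)(v := Moving)\<rparr>)"
| inspect:
    "phase s = Visit (kd, B) l \<Longrightarrow> task s v = Marking A W \<Longrightarrow> w \<in> A \<Longrightarrow>
     W' = (if {v, w} \<in> B \<and> marked s w \<or> trigger kd s v w then insert w W else W) \<Longrightarrow>
     update_step n \<delta> lam pick s (s\<lparr>task := (task s)(v := Marking (A - {w}) W')\<rparr>)"
| union:
    "phase s = Visit (kd, B) l \<Longrightarrow> task s v = Marking {} W \<Longrightarrow> w \<in> W \<Longrightarrow>
     root_of s v r1 \<Longrightarrow> root_of s w r2 \<Longrightarrow>
     update_step n \<delta> lam pick s
       ((link pick r1 r2 s)\<lparr>task := (task s)(v := Marking {} (W - {w}))\<rparr>)"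
| write_descriptor:
    "phase s = Visit (kd, B) l \<Longrightarrow> task s v = Marking {} {} \<Longrightarrow> new_desc s v = Some d \<Longrightarrow>
     update_step n \<delta> lam pick s
       (s\<lparr>desc_array := (desc_array s)(v := d), new_desc := (new_desc s)(v := None),
          task := (task s)(v := Moving)\<rparr>)"
| change_level:
    "phase s = Visit (kd, B) l \<Longrightarrow> task s v = Moving \<Longrightarrow>
     update_step n \<delta> lam pick s (move kd l v s)"
| next_level:
    "phase s = Visit (kd, B) l \<Longrightarrow> \<forall>v<n. task s v = Idle \<and> \<not> must_move n \<delta> lam kd l s v \<Longrightarrow>
     recompute s = {} \<Longrightarrow>
     update_step n \<delta> lam pick s
       (s\<lparr>phase := (if l + 1 < num_levels n \<delta> then Visit (kd, B) (l + 1) else Unmark_Roots)\<rparr>)"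
| unmark_root:
    "phase s = Unmark_Roots \<Longrightarrow> desc_array s v = Marked I_AM_ROOT ol \<Longrightarrow>
     update_step n \<delta> lam pick s (s\<lparr>desc_array := (desc_array s)(v := UNMARKED)\<rparr>)"
| roots_done:
    "phase s = Unmark_Roots \<Longrightarrow> \<forall>v ol. desc_array s v \<noteq> Marked I_AM_ROOT ol \<Longrightarrow>
     update_step n \<delta> lam pick s (s\<lparr>phase := Unmark_Rest\<rparr>)"
| unmark_rest:
    "phase s = Unmark_Rest \<Longrightarrow> marked s v \<Longrightarrow>
     update_step n \<delta> lam pick s (s\<lparr>desc_array := (desc_array s)(v := UNMARKED)\<rparr>)"
| end_batch:
    "phase s = Unmark_Rest \<Longrightarrow> \<forall>v. \<not> marked s v \<Longrightarrow>
     update_step n \<delta> lam pick s (s\<lparr>phase := Between\<rparr>)"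

text \<open>Path compression by some traversal, at any time.\<close>

inductive compress_step :: "config \<Rightarrow> config \<Rightarrow> bool" where
  "(u, p) \<in> parent_rel s \<Longrightarrow> root_of s u r \<Longrightarrow> compress_step s (redirect u r s)"


section \<open>Read processes\<close>

datatype dag_status = DAG_MARKED | DAG_UNMARKED

text \<open>Local state of a read process; \<open>Stepi\<close> means that step (i) of \<open>read\<close> is to be executed next.
  The arguments are the vertex and the values of \<open>b\<^sub>1\<close>, \<open>l\<^sub>1\<close>, \<open>desc\<close>, \<open>status\<close>, \<open>l\<^sub>2\<close>; the last argument
  of \<open>Step4\<close> is the descriptor reached by the traversal in \<open>check_DAG\<close>.  \<open>Returned v l k\<close>: the read of
  \<open>v\<close> has returned \<open>k\<close>, computed from the level \<open>l\<close>.\<close>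

datatype reader =
    Inactive
  | Step1 nat
  | Step2 nat nat
  | Step3 nat nat nat
  | Step4 nat nat nat descriptor descriptor
  | Step5 nat nat nat descriptor dag_status
  | Step6 nat nat nat descriptor dag_status nat
  | Returned nat nat real

inductive read_step :: "nat \<Rightarrow> real \<Rightarrow> config \<Rightarrow> reader \<Rightarrow> reader \<Rightarrow> bool" for n \<delta> s where
  invoke: "v < n \<Longrightarrow> read_step n \<delta> s Inactive (Step1 v)"
| finish: "read_step n \<delta> s (Returned v l k) Inactive"
| read1: "read_step n \<delta> s (Step1 v) (Step2 v (batch_number s))"
| read2: "read_step n \<delta> s (Step2 v b1) (Step3 v b1 (level s v))"
| read3: "read_step n \<delta> s (Step3 v b1 l1) (Step4 v b1 l1 (desc_array s v) (desc_array s v))"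
| check_unmarked: "read_step n \<delta> s (Step4 v b1 l1 d UNMARKED) (Step5 v b1 l1 d DAG_UNMARKED)"
| check_parent: "read_step n \<delta> s (Step4 v b1 l1 d (Marked (Parent p) ol)) (Step4 v b1 l1 d (desc_array s p))"
| check_root: "read_step n \<delta> s (Step4 v b1 l1 d (Marked I_AM_ROOT ol)) (Step5 v b1 l1 d DAG_MARKED)"
| read5: "read_step n \<delta> s (Step5 v b1 l1 d st) (Step6 v b1 l1 d st (level s v))"
| retry_batch: "b1 \<noteq> batch_number s \<Longrightarrow> read_step n \<delta> s (Step6 v b1 l1 d st l2) (Step1 v)"
| return_old:
    "b1 = batch_number s \<Longrightarrow> st = DAG_MARKED \<Longrightarrow>
     read_step n \<delta> s (Step6 v b1 l1 d st l2) (Returned v (old_level d) (estimate n \<delta> (old_level d)))"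
| return_live:
    "b1 = batch_number s \<Longrightarrow> st \<noteq> DAG_MARKED \<Longrightarrow> l1 = l2 \<Longrightarrow>
     read_step n \<delta> s (Step6 v b1 l1 d st l2) (Returned v l1 (estimate n \<delta> l1))"
| retry_level:
    "b1 = batch_number s \<Longrightarrow> st \<noteq> DAG_MARKED \<Longrightarrow> l1 \<noteq> l2 \<Longrightarrow>
     read_step n \<delta> s (Step6 v b1 l1 d st l2) (Step1 v)"


section \<open>Executions\<close>

text \<open>An execution is an infinite sequence of global states, consisting of the shared configuration and
  the local states of the read processes (indexed by \<open>'p\<close>); each transition is a step of an update
  process, a path compression, a step of one read process, or a stuttering step.\<close>

type_synonym 'p execution_state = "config \<times> ('p \<Rightarrow> reader)"

inductive system_step ::
  "nat \<Rightarrow> real \<Rightarrow> real \<Rightarrow> (config \<Rightarrow> nat \<Rightarrow> nat \<Rightarrow> nat) \<Rightarrow> 'p execution_state \<Rightarrow> 'p execution_state \<Rightarrow> bool"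
  for n \<delta> lam pick where
  update: "update_step n \<delta> lam pick s s' \<Longrightarrow> system_step n \<delta> lam pick (s, R) (s', R)"
| compress: "compress_step s s' \<Longrightarrow> system_step n \<delta> lam pick (s, R) (s', R)"
| read: "read_step n \<delta> s (R p) r \<Longrightarrow> system_step n \<delta> lam pick (s, R) (s, R(p := r))"
| stutter: "system_step n \<delta> lam pick (s, R) (s, R)"

text \<open>The root of a DAG is marked before the other members are, also while DAGs are merged.  That it is
  unmarked before them is a consequence of the order of the two rounds of \<open>unmark_all\<close>.\<close>

definition root_marked_first :: "config \<Rightarrow> bool" where
  "root_marked_first s \<longleftrightarrow> (\<forall>u r. marked s u \<and> root_of s u r \<longrightarrow> marked s r)"

text \<open>Update processes do not fail and have bounded delays, hence while a batch is being executed some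
  update process eventually takes a step.  Read processes are not subject to any progress
  condition.\<close>

definition execution ::
  "nat \<Rightarrow> real \<Rightarrow> real \<Rightarrow> (config \<Rightarrow> nat \<Rightarrow> nat \<Rightarrow> nat) \<Rightarrow> (nat \<Rightarrow> 'p execution_state) \<Rightarrow> bool" where
  "execution n \<delta> lam pick \<sigma> \<longleftrightarrow>
     initial n \<delta> lam (fst (\<sigma> 0)) \<and> (\<forall>p. snd (\<sigma> 0) p = Inactive) \<and>
     (\<forall>t. system_step n \<delta> lam pick (\<sigma> t) (\<sigma> (Suc t))) \<and>
     (\<forall>t. root_marked_first (fst (\<sigma> t))) \<and>
     (\<forall>t. phase (fst (\<sigma> t)) \<noteq> Between \<longrightarrow>
        (\<exists>t'\<ge>t. update_step n \<delta> lam pick (fst (\<sigma> t')) (fst (\<sigma> (Suc t')))))"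

end

(*
  Linearizability: while a batch is being executed, an unmarked vertex has not moved, a marked one
  carries its level at the start of the batch in old_level, and once the unmarking has begun all
  levels are final.  During the visits a marked vertex only has marked ancestors, so a traversal
  that meets an unmarked descriptor finishes after the unmarking has begun (or found v itself
  unmarked); a read of a marked v that does not return old_level thus reads a final level as l2.

  Invariants: visiting level l upwards leaves Z_j unchanged for j <= l, hence settled vertices stay
  settled, and a deletion never creates a desire level below the visited one.

  Approximation: Invariant 1 at the lowest vertex of the k-core bounds k from above.  For the other
  direction, Invariant 2 and peeling outside the (k+1)-core show that the number of vertices of Z_j
  outside that core shrinks by the factor 1 + delta at each level of a group, so that it vanishes
  within one group.
*)

theory Submission
  imports Defs
begin

section \<open>Cores\<close>

lemma all_edges_iff [simp]: "{u, w} \<in> all_edges n \<longleftrightarrow> u < n \<and> w < n \<and> u \<noteq> w"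
  unfolding all_edges_def by (auto simp: doubleton_eq_iff)

text \<open>Sets of minimum induced degree at least \<open>k\<close> are closed under union, so this
  union is the unique maximal one, available as a term.\<close>

definition core :: "nat \<Rightarrow> nat set set \<Rightarrow> nat \<Rightarrow> nat set" where
  "core n E k = \<Union>{S. S \<subseteq> {..<n} \<and> min_induced_degree_ge E k S}"

lemma core_subset: "core n E k \<subseteq> {..<n}"
  unfolding core_def by blast

lemma core_greatest: "S \<subseteq> {..<n} \<Longrightarrow> min_induced_degree_ge E k S \<Longrightarrow> S \<subseteq> core n E k"
  unfolding core_def by blast

lemma min_induced_degree_ge_core: "min_induced_degree_ge E k (core n E k)"
  unfolding min_induced_degree_ge_def
proof
  fix v assume "v \<in> core n E k"
  then obtain S where S: "S \<subseteq> {..<n}" "min_induced_degree_ge E k S" "v \<in> S"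
    unfolding core_def by blast
  have "k \<le> card {w \<in> S. {v, w} \<in> E}"
    using S unfolding min_induced_degree_ge_def by blast
  also have "\<dots> \<le> card {w \<in> core n E k. {v, w} \<in> E}"
    by (intro card_mono finite_subset[OF _ finite_lessThan[of n]])
      (use core_subset core_greatest[OF S(1,2)] in blast)+
  finally show "k \<le> card {w \<in> core n E k. {v, w} \<in> E}" .
qed

lemma is_core_iff: "is_core n E k S \<longleftrightarrow> S = core n E k"
  unfolding is_core_def
  using core_subset core_greatest min_induced_degree_ge_core by (metis subset_antisym)

lemma core_antimono: "j \<le> k \<Longrightarrow> core n E k \<subseteq> core n E j"
  using core_greatest[OF core_subset, of E j n E k] min_induced_degree_ge_core[of E k n]
  unfolding min_induced_degree_ge_def by (meson order_trans)

lemma core_0: "core n E 0 = {..<n}"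
  using core_subset core_greatest[of "{..<n}" n E 0]
  by (auto simp: min_induced_degree_ge_def)

lemma core_eq_empty: "core n E (Suc n) = {}"
proof (rule ccontr)
  assume "core n E (Suc n) \<noteq> {}"
  then obtain v where "v \<in> core n E (Suc n)" by blast
  then have "Suc n \<le> card {w \<in> core n E (Suc n). {v, w} \<in> E}"
    using min_induced_degree_ge_core unfolding min_induced_degree_ge_def by blast
  also have "\<dots> \<le> card {..<n}"
    by (rule card_mono) (use core_subset in auto)
  finally show False by simp
qed

text \<open>The cores decrease from all vertices at \<open>0\<close> to the empty set at
  \<open>Suc n\<close>, so \<open>v\<close> drops out exactly once and the description in
  \<open>coreness\<close> denotes.\<close>

lemma coreness_core:
  assumes "v < n"
  shows "v \<in> core n E (coreness n E v)" and "v \<notin> core n E (Suc (coreness n E v))"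
proof -
  let ?P = "\<lambda>k. v \<in> core n E k \<and> v \<notin> core n E (Suc k)"
  have "\<exists>k. ?P k"
  proof (rule ccontr)
    assume "\<nexists>k. ?P k"
    then have "v \<in> core n E k" for k
      by (induction k) (use assms core_0 in auto)
    then show False using core_eq_empty by blast
  qed
  moreover have "k = k'" if "?P k" "?P k'" for k k'
    using that core_antimono[of "Suc k" k' n E] core_antimono[of "Suc k'" k n E]
    by (metis linorder_neqE_nat Suc_leI subsetD)
  ultimately have "?P (THE k. ?P k)"
    by (metis (mono_tags, lifting) theI)
  then have "?P (coreness n E v)"
    by (simp add: coreness_def is_core_iff)
  then show "v \<in> core n E (coreness n E v)" "v \<notin> core n E (Suc (coreness n E v))"
    by auto
qed

text \<open>Peeling: removing the vertices of \<open>X\<close> one by one, each with at most \<open>k\<close> remaining neighbours,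
  destroys at most \<open>k\<close> edges per vertex.\<close>

lemma sum_degrees_peeling:
  assumes "finite X" and "finite D"
    and "\<And>Y. Y \<subseteq> X \<Longrightarrow> Y \<noteq> {} \<Longrightarrow> \<exists>u\<in>Y. card {w \<in> Y \<union> D. {u, w} \<in> E} \<le> k"
  shows "(\<Sum>u\<in>X. card {w \<in> X \<union> D. {u, w} \<in> E}) \<le> 2 * k * card X"
  using assms(1,3)
proof (induction X rule: finite_psubset_induct)
  case (psubset X)
  show ?case
  proof (cases "X = {}")
    case False
    \<comment> \<open>Removing \<open>u\<close> costs its own degree and one unit at each of its
      neighbours, at most \<open>2 * k\<close> in total.\<close>
    then obtain u where u: "u \<in> X" "card {w \<in> X \<union> D. {u, w} \<in> E} \<le> k"
      using psubset.prems by blast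
    define X' where "X' = X - {u}"
    have X: "X = insert u X'" "u \<notin> X'" "finite X'" "X' \<subset> X"
      using u psubset.hyps unfolding X'_def by auto
    have IH: "(\<Sum>x\<in>X'. card {w \<in> X' \<union> D. {x, w} \<in> E}) \<le> 2 * k * card X'"
    proof (rule psubset.IH[OF X(4)])
      fix Y assume "Y \<subseteq> X'" "Y \<noteq> {}"
      then show "\<exists>u\<in>Y. card {w \<in> Y \<union> D. {u, w} \<in> E} \<le> k"
        using psubset.prems[of Y] X(4) by blast
    qed
    have step: "card {w \<in> X \<union> D. {x, w} \<in> E}
        \<le> card {w \<in> X' \<union> D. {x, w} \<in> E} + (if {x, u} \<in> E then 1 else 0)" for x
    proof -
      have "card {w \<in> X \<union> D. {x, w} \<in> E}
          \<le> card ({w \<in> X' \<union> D. {x, w} \<in> E} \<union> (if {x, u} \<in> E then {u} else {}))"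
        by (rule card_mono) (use X assms(2) in auto)
      also have "\<dots> \<le> card {w \<in> X' \<union> D. {x, w} \<in> E} + card (if {x, u} \<in> E then {u} else {})"
        by (rule card_Un_le)
      finally show ?thesis by (auto split: if_splits)
    qed
    have "(\<Sum>x\<in>X'. if {x, u} \<in> E then 1 else 0) = card {x \<in> X'. {x, u} \<in> E}"
      using X(3) by (simp flip: sum.inter_filter)
    also have "\<dots> \<le> card {w \<in> X \<union> D. {u, w} \<in> E}"
      by (rule card_mono) (use X assms(2) in \<open>auto simp: insert_commute\<close>)
    finally have ind: "(\<Sum>x\<in>X'. if {x, u} \<in> E then 1 else 0) \<le> k"
      using u(2) by simp
    have "(\<Sum>x\<in>X. card {w \<in> X \<union> D. {x, w} \<in> E})
        = card {w \<in> X \<union> D. {u, w} \<in> E} + (\<Sum>x\<in>X'. card {w \<in> X \<union> D. {x, w} \<in> E})"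
      using sum.insert[OF X(3,2), of "\<lambda>x. card {w \<in> X \<union> D. {x, w} \<in> E}"]
      unfolding X(1)[symmetric] .
    also have "\<dots> \<le> k + (\<Sum>x\<in>X'. card {w \<in> X' \<union> D. {x, w} \<in> E} + (if {x, u} \<in> E then 1 else 0))"
      by (intro add_mono u(2) sum_mono step)
    also have "\<dots> \<le> k + (2 * k * card X' + k)"
      using IH ind by (simp add: sum.distrib)
    also have "\<dots> = 2 * k * card X"
      using X by simp
    finally show ?thesis .
  qed simp
qed


section \<open>The invariants of the level data structure\<close>

lemma redirect_simps [simp]:
  "graph (redirect u p s) = graph s" "level (redirect u p s) = level s"
  "batch_number (redirect u p s) = batch_number s" "phase (redirect u p s) = phase s"
  "task (redirect u p s) = task s" "desire (redirect u p s) = desire s"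
  "recompute (redirect u p s) = recompute s"
  unfolding redirect_def by (auto split: option.split)

lemma link_simps [simp]:
  "graph (link pick r1 r2 s) = graph s" "level (link pick r1 r2 s) = level s"
  "batch_number (link pick r1 r2 s) = batch_number s" "phase (link pick r1 r2 s) = phase s"
  "task (link pick r1 r2 s) = task s" "desire (link pick r1 r2 s) = desire s"
  "recompute (link pick r1 r2 s) = recompute s"
  unfolding link_def by auto

locale level_structure =
  fixes n :: nat and \<delta> lam :: real
  assumes \<delta>_pos: "\<delta> > 0" and lam_pos: "lam > 0"
begin

abbreviation inv1 :: "config \<Rightarrow> nat \<Rightarrow> bool" where
  "inv1 s v \<equiv> inv1_at n \<delta> lam (graph s) (level s) v (level s v)"

abbreviation inv2 :: "config \<Rightarrow> nat \<Rightarrow> bool" where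
  "inv2 s v \<equiv> inv2_at n \<delta> (graph s) (level s) v (level s v)"

abbreviation true_desire :: "config \<Rightarrow> nat \<Rightarrow> nat option" where
  "true_desire s v \<equiv> desire_level n \<delta> (graph s) (level s) v"

section \<open>Monotonicity of the invariants and desire levels\<close>

lemma nbrs_from_subset: "E \<subseteq> all_edges n \<Longrightarrow> nbrs_from E lev v l \<subseteq> {..<n}"
  unfolding nbrs_from_def by auto

lemma finite_nbrs_from: "E \<subseteq> all_edges n \<Longrightarrow> finite (nbrs_from E lev v l)"
  by (rule finite_subset[OF nbrs_from_subset]) auto

lemma power_group_of_mono:
  "l \<le> l' \<Longrightarrow> (1 + \<delta>) ^ group_of n \<delta> l \<le> (1 + \<delta>) ^ group_of n \<delta> l'"
  using \<delta>_pos unfolding group_of_def by (intro power_increasing div_le_mono) auto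

lemma coefficient_ge_1: "1 \<le> 2 + 3 / lam"
  using lam_pos by (simp add: add_increasing2)

lemma scaled_power_ge: "(1 + \<delta>) ^ m \<le> (2 + 3 / lam) * (1 + \<delta>) ^ m"
  using mult_right_mono[OF coefficient_ge_1, of "(1 + \<delta>) ^ m"] \<delta>_pos by (simp only: mult_1) simp

text \<open>An upper bound on a number of neighbours survives every change that only shrinks the
  counted set; dually for Invariant 2 below.\<close>

lemma inv1_at_subset:
  assumes "E \<subseteq> all_edges n" and "nbrs_from E' lev' v l \<subseteq> nbrs_from E lev v l"
    and "inv1_at n \<delta> lam E lev v l"
  shows "inv1_at n \<delta> lam E' lev' v l"
  using card_mono[OF finite_nbrs_from[OF assms(1)] assms(2)] assms(3)
  unfolding inv1_at_def by force

lemma inv2_at_subset: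
  assumes "E' \<subseteq> all_edges n" and "nbrs_from E lev v (l - 1) \<subseteq> nbrs_from E' lev' v (l - 1)"
    and "inv2_at n \<delta> E lev v l"
  shows "inv2_at n \<delta> E' lev' v l"
  using card_mono[OF finite_nbrs_from[OF assms(1)] assms(2)] assms(3)
  unfolding inv2_at_def by force

text \<open>Going down enlarges the counted set and does not raise the threshold. So the levels
  admissible for Invariant 2 form an initial segment.\<close>

lemma inv2_at_antimono:
  assumes "E \<subseteq> all_edges n" and "inv2_at n \<delta> E lev v l" and "l' \<le> l"
  shows "inv2_at n \<delta> E lev v l'"
proof (cases "l' = 0")
  case False
  have "nbrs_from E lev v (l - 1) \<subseteq> nbrs_from E lev v (l' - 1)"
    using assms(3) unfolding nbrs_from_def by auto
  from card_mono[OF finite_nbrs_from[OF assms(1)] this]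
  show ?thesis
    using False assms(2,3) power_group_of_mono[of "l' - 1" "l - 1"]
    unfolding inv2_at_def by force
qed (simp add: inv2_at_def)

text \<open>Both invariants count the same neighbours here and refer to the same group, and the
  lower threshold does not exceed the upper one. This settles the vertex that has just moved:
  directly for deletions, by contraposition for insertions.\<close>

lemma not_inv2_at_Suc_imp_inv1_at: "\<not> inv2_at n \<delta> E lev v (Suc l) \<Longrightarrow> inv1_at n \<delta> lam E lev v l"
  unfolding inv1_at_def inv2_at_def
  by (auto simp: not_le intro: order_trans[OF less_imp_le scaled_power_ge])

lemma not_inv1_at_imp_inv2_at_Suc: "\<not> inv1_at n \<delta> lam E lev v l \<Longrightarrow> inv2_at n \<delta> E lev v (Suc l)"
  using not_inv2_at_Suc_imp_inv1_at by blast

lemma desire_level_eq_None: "desire_level n \<delta> E lev v = None \<longleftrightarrow> inv2_at n \<delta> E lev v (lev v)"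
  unfolding desire_level_def by auto

text \<open>The maximum of an initial segment is where Invariant 2 switches from true to false. Only
  two adjacent levels occur, so the effect of a move is easy to track.\<close>

lemma desire_level_eq_Some:
  assumes "E \<subseteq> all_edges n"
  shows "desire_level n \<delta> E lev v = Some d \<longleftrightarrow>
    d < lev v \<and> inv2_at n \<delta> E lev v d \<and> \<not> inv2_at n \<delta> E lev v (Suc d)" (is "?L \<longleftrightarrow> ?R")
proof
  let ?A = "{l. l < lev v \<and> inv2_at n \<delta> E lev v l}"
  have fin: "finite ?A" by simp
  show ?R if ?L
  proof -
    from that have no: "\<not> inv2_at n \<delta> E lev v (lev v)" and d: "d = Max ?A"
      unfolding desire_level_def by (auto split: if_splits)
    \<comment> \<open>Invariant 2 is vacuous at level 0, so the maximum is over a nonempty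
      set.\<close>
    have "lev v \<noteq> 0" using no by (metis inv2_at_def less_irrefl)
    then have "0 \<in> ?A" by (simp add: inv2_at_def)
    then have "d \<in> ?A" using d Max_in[OF fin] by blast
    moreover have "\<not> inv2_at n \<delta> E lev v (Suc d)"
    proof
      assume *: "inv2_at n \<delta> E lev v (Suc d)"
      with no \<open>d \<in> ?A\<close> have "Suc d \<in> ?A" by (metis (mono_tags) Suc_lessI mem_Collect_eq)
      then show False using Max_ge[OF fin] d by fastforce
    qed
    ultimately show ?R by blast
  qed
  show ?L if ?R
  proof -
    have "\<not> inv2_at n \<delta> E lev v (lev v)"
      using that inv2_at_antimono[OF assms] by (meson Suc_leI)
    moreover have "Max ?A = d"
    proof (rule Max_eqI[OF fin])
      fix l assume "l \<in> ?A"
      then show "l \<le> d"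
        using that inv2_at_antimono[OF assms, of lev v l "Suc d"] by (metis mem_Collect_eq not_less_eq_eq)
    qed (use that in auto)
    ultimately show ?L unfolding desire_level_def by simp
  qed
qed


subsection \<open>Approximation of the coreness\<close>

lemma num_levels_posD:
  assumes "0 < num_levels n \<delta>"
  shows "0 < ceil_log n \<delta>" and "real n \<le> (1 + \<delta>) ^ ceil_log n \<delta>"
proof -
  show c: "0 < ceil_log n \<delta>"
    using assms unfolding num_levels_def group_size_def by simp
  then have "0 < log (1 + \<delta>) (real n)" unfolding ceil_log_def by simp
  then have n: "0 < n" by (cases n) (auto simp: log_def)
  have "log (1 + \<delta>) (real n) \<le> real (ceil_log n \<delta>)"
    unfolding ceil_log_def by linarith
  then have "real n \<le> (1 + \<delta>) powr real (ceil_log n \<delta>)"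
    using \<delta>_pos n by (subst (asm) log_le_iff) auto
  then show "real n \<le> (1 + \<delta>) ^ ceil_log n \<delta>"
    using \<delta>_pos by (simp add: powr_realpow)
qed

text \<open>A lowest vertex \<open>w\<close> of the core has all its core neighbours at or above its
  own level, where Invariant 1 bounds their number; and \<open>w\<close> is not above
  \<open>v\<close>.\<close>

lemma coreness_le_estimate:
  assumes E: "E \<subseteq> all_edges n" and "v < n"
    and inv1: "\<And>u. u < n \<Longrightarrow> lev u < num_levels n \<delta> \<and> inv1_at n \<delta> lam E lev u (lev u)"
  shows "real (coreness n E v) \<le> (2 + 3 / lam) * (1 + \<delta>) * estimate n \<delta> (lev v)"
proof -
  let ?k = "coreness n E v"
  define S where "S = core n E ?k"
  have S: "S \<subseteq> {..<n}" "v \<in> S" "min_induced_degree_ge E ?k S"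
    using core_subset coreness_core[OF \<open>v < n\<close>] min_induced_degree_ge_core unfolding S_def by auto
  have "finite S" using S(1) finite_subset by blast
  then obtain w where w: "w \<in> S" "\<And>u. u \<in> S \<Longrightarrow> lev w \<le> lev u"
    using S(2) by (metis arg_min_if_finite(1) arg_min_least empty_iff)
  have "?k \<le> card {u \<in> S. {w, u} \<in> E}"
    using S(3) w(1) unfolding min_induced_degree_ge_def by blast
  also have "\<dots> \<le> card (nbrs_from E lev w (lev w))"
    using w(2) by (intro card_mono finite_nbrs_from[OF E]) (auto simp: nbrs_from_def)
  finally have "real ?k \<le> real (card (nbrs_from E lev w (lev w)))" by simp
  also have "\<dots> \<le> (2 + 3 / lam) * (1 + \<delta>) ^ group_of n \<delta> (lev w)"
    using inv1[of w] w(1) S(1) unfolding inv1_at_def by auto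
  \<comment> \<open>\<open>Suc\<close> makes up for the truncated predecessor in the exponent of
    \<open>estimate\<close>; this costs the factor \<open>1 + \<delta>\<close>.\<close>
  also have "\<dots> \<le> (2 + 3 / lam) * (1 + \<delta>) ^ Suc ((lev v + 1) div group_size n \<delta> - 1)"
  proof (intro mult_left_mono power_increasing)
    have "lev w div group_size n \<delta> \<le> (lev v + 1) div group_size n \<delta>"
      using w(2)[OF S(2)] by (intro div_le_mono) simp
    then show "group_of n \<delta> (lev w) \<le> Suc ((lev v + 1) div group_size n \<delta> - 1)"
      unfolding group_of_def by simp
  qed (use \<delta>_pos coefficient_ge_1 in auto)
  finally show ?thesis by (simp add: estimate_def mult.assoc)
qed

text \<open>Double counting: Invariant 2 gives each vertex of \<open>X (Suc j)\<close> many
  neighbours at levels from \<open>j\<close> on, while peeling bounds the degree sum over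
  \<open>X j\<close>.\<close>

lemma levels_outside_core_shrink:
  fixes k :: nat
  assumes E: "E \<subseteq> all_edges n"
    and inv2: "\<And>u. u < n \<Longrightarrow> inv2_at n \<delta> E lev u (lev u)"
  defines "X \<equiv> \<lambda>j. {u. u < n \<and> j \<le> lev u} - core n E (Suc k)"
  shows "(1 + \<delta>) ^ group_of n \<delta> j * real (card (X (Suc j))) \<le> 2 * real k * real (card (X j))"
proof -
  define C where "C = core n E (Suc k)"
  define D where "D = {u. u < n \<and> j \<le> lev u} \<inter> C"
  have fin: "finite (X i)" "finite D" for i unfolding X_def D_def by auto
  have XD: "X j \<union> D = {u. u < n \<and> j \<le> lev u}" unfolding X_def D_def C_def by blast
  \<comment> \<open>If every vertex of \<open>Y\<close> had more than \<open>k\<close> such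
    neighbours, \<open>Y \<union> C\<close> would have minimum degree \<open>Suc k\<close>, so
    \<open>Y\<close> would lie inside the core that it avoids.\<close>
  have peel: "\<exists>u\<in>Y. card {w \<in> Y \<union> D. {u, w} \<in> E} \<le> k" if Y: "Y \<subseteq> X j" "Y \<noteq> {}" for Y
  proof (rule ccontr)
    assume *: "\<not> ?thesis"
    have YC: "Y \<union> C \<subseteq> {..<n}" using Y core_subset unfolding X_def C_def by auto
    have "min_induced_degree_ge E (Suc k) (Y \<union> C)"
      unfolding min_induced_degree_ge_def
    proof
      fix u assume "u \<in> Y \<union> C"
      then obtain T where T: "T \<subseteq> Y \<union> C" "Suc k \<le> card {w \<in> T. {u, w} \<in> E}"
      proof
        assume "u \<in> Y"
        then show thesis using that[of "Y \<union> D"] * unfolding D_def by fastforce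
      next
        assume "u \<in> C"
        then show thesis using that[of C] min_induced_degree_ge_core
          unfolding C_def min_induced_degree_ge_def by blast
      qed
      note T(2)
      also have "card {w \<in> T. {u, w} \<in> E} \<le> card {w \<in> Y \<union> C. {u, w} \<in> E}"
        by (intro card_mono finite_subset[OF _ finite_lessThan[of n]]) (use YC T(1) in blast)+
      finally show "Suc k \<le> card {w \<in> Y \<union> C. {u, w} \<in> E}" .
    qed
    then have "Y \<subseteq> C" using core_greatest[OF YC] unfolding C_def by blast
    then show False using Y unfolding X_def C_def by blast
  qed
  have deg: "(1 + \<delta>) ^ group_of n \<delta> j \<le> real (card {w \<in> X j \<union> D. {u, w} \<in> E})"
    if "u \<in> X (Suc j)" for u
  proof -
    \<comment> \<open>\<open>u\<close> may be higher up; Invariant 2 passes down to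
      \<open>Suc j\<close>, where it counts the neighbours from level \<open>j\<close> on.\<close>
    have "inv2_at n \<delta> E lev u (Suc j)"
      using that inv2 inv2_at_antimono[OF E] unfolding X_def by blast
    moreover have "nbrs_from E lev u j = {w \<in> X j \<union> D. {u, w} \<in> E}"
      using nbrs_from_subset[OF E] unfolding XD nbrs_from_def by blast
    ultimately show ?thesis unfolding inv2_at_def by simp
  qed
  have "(1 + \<delta>) ^ group_of n \<delta> j * real (card (X (Suc j)))
      \<le> (\<Sum>u\<in>X (Suc j). real (card {w \<in> X j \<union> D. {u, w} \<in> E}))"
    using sum_mono[OF deg, of "X (Suc j)"] by (simp add: mult.commute)
  also have "\<dots> \<le> (\<Sum>u\<in>X j. real (card {w \<in> X j \<union> D. {u, w} \<in> E}))"
    by (intro sum_mono2 fin) (auto simp: X_def)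
  also have "\<dots> \<le> real (2 * k * card (X j))"
    using sum_degrees_peeling[OF fin peel] by (simp flip: of_nat_sum del: of_nat_mult)
  finally show ?thesis by simp
qed

text \<open>Were the estimate too large, Invariant 2 in group \<open>i\<close> would force the
  vertices outside the core to shrink geometrically and die out by the last level of that group,
  although \<open>v\<close> is still there.\<close>

lemma estimate_le_coreness:
  assumes E: "E \<subseteq> all_edges n" and v: "v < n" and K: "0 < num_levels n \<delta>"
    and inv2: "\<And>u. u < n \<Longrightarrow> inv2_at n \<delta> E lev u (lev u)"
    and k_pos: "1 \<le> coreness n E v"
  shows "estimate n \<delta> (lev v) \<le> (2 + 3 / lam) * (1 + \<delta>) * real (coreness n E v)"
proof (cases "(lev v + 1) div group_size n \<delta> = 0")
  case True
  have "1 \<le> (2 + 3 / lam) * (1 + \<delta>)"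
    using mult_mono[OF coefficient_ge_1, of 1 "1 + \<delta>"] \<delta>_pos coefficient_ge_1 by simp
  then have "1 \<le> (2 + 3 / lam) * (1 + \<delta>) * real (coreness n E v)"
    using mult_mono[of 1 "(2 + 3 / lam) * (1 + \<delta>)" 1 "real (coreness n E v)"] k_pos by simp
  then show ?thesis using True by (simp add: estimate_def)
next
  case False
  define k where "k = coreness n E v"
  define g where "g = group_size n \<delta>"
  \<comment> \<open>The exponent of the estimate; nothing is truncated in this case, and group
    \<open>i\<close> lies entirely at or below the level of \<open>v\<close>.\<close>
  define i where "i = (lev v + 1) div g - 1"
  define X where "X = (\<lambda>j. {u. u < n \<and> j \<le> lev u} - core n E (Suc k))"
  have g: "g = 4 * ceil_log n \<delta>" "0 < g"
    using num_levels_posD[OF K] unfolding g_def group_size_def by auto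
  have pos: "0 < (1 + \<delta>) ^ m" for m using \<delta>_pos by simp
  show ?thesis
  proof (rule ccontr)
    assume "\<not> ?thesis"
    then have small: "(2 + 3 / lam) * (1 + \<delta>) * real k < (1 + \<delta>) ^ i"
      by (simp add: estimate_def k_def i_def g_def)
    \<comment> \<open>The 2 pays for edges counted at both ends, the factor
      \<open>1 + \<delta>\<close> for the rate of shrinking.\<close>
    have "2 * (1 + \<delta>) * real k \<le> (2 + 3 / lam) * (1 + \<delta>) * real k"
      using lam_pos \<delta>_pos by (intro mult_right_mono) auto
    with small have small2: "2 * (1 + \<delta>) * real k \<le> (1 + \<delta>) ^ i" by simp
    \<comment> \<open>The levels \<open>i * g, \<dots>, i * g + (g - 1)\<close> form group \<open>i\<close>.\<close>
    have decay: "real (card (X (i * g + m))) * (1 + \<delta>) ^ m \<le> real n" if "m < g" for m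
      using that
    proof (induction m)
      case 0
      have "card (X (i * g)) \<le> card {..<n}"
        unfolding X_def by (rule card_mono) auto
      then show ?case by simp
    next
      case (Suc m)
      let ?a = "real (card (X (i * g + m)))" and ?b = "real (card (X (i * g + Suc m)))"
      have "group_of n \<delta> (i * g + m) = i"
        using Suc.prems unfolding group_of_def g_def by simp
      with levels_outside_core_shrink[OF E inv2, where j = "i * g + m" and k = k]
      have "(1 + \<delta>) ^ i * ?b \<le> 2 * real k * ?a" unfolding X_def by simp
      then have "(1 + \<delta>) * ((1 + \<delta>) ^ i * ?b) \<le> (1 + \<delta>) * (2 * real k * ?a)"
        using \<delta>_pos by (intro mult_left_mono) auto
      also have "\<dots> = (2 * (1 + \<delta>) * real k) * ?a" by (simp add: algebra_simps)
      also have "\<dots> \<le> (1 + \<delta>) ^ i * ?a" by (intro mult_right_mono small2) auto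
      finally have "(1 + \<delta>) ^ i * (?b * (1 + \<delta>)) \<le> (1 + \<delta>) ^ i * ?a" by (simp add: mult_ac)
      then have "?b * (1 + \<delta>) \<le> ?a" using pos by (simp only: mult_le_cancel_left_pos)
      then have "?b * (1 + \<delta>) * (1 + \<delta>) ^ m \<le> ?a * (1 + \<delta>) ^ m"
        using pos[of m] by (intro mult_right_mono) auto
      also have "\<dots> \<le> real n" using Suc by simp
      finally show ?case by (simp add: mult_ac)
    qed
    \<comment> \<open>By the \<open>+ 1\<close> in \<open>estimate\<close>, \<open>v\<close> may be
      at the last level of group \<open>i\<close> itself; hence \<open>g - 1\<close> steps of decay
      and not \<open>g\<close>.\<close>
    have "(i + 1) * g \<le> lev v + 1"
      using False unfolding i_def g_def by (simp add: div_times_less_eq_dividend)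
    then have "i * g + (g - 1) \<le> lev v" using g(2) by (simp add: algebra_simps)
    then have "v \<in> X (i * g + (g - 1))"
      using v coreness_core(2)[OF v] unfolding X_def k_def by simp
    moreover have "finite (X (i * g + (g - 1)))" unfolding X_def by simp
    ultimately have "1 \<le> real (card (X (i * g + (g - 1))))"
      by (metis One_nat_def Suc_leI card_gt_0_iff empty_iff of_nat_1 of_nat_mono)
    then have "(1 + \<delta>) ^ (g - 1) \<le> real (card (X (i * g + (g - 1)))) * (1 + \<delta>) ^ (g - 1)"
      using pos[of "g - 1"] by simp
    also have "\<dots> \<le> (1 + \<delta>) ^ ceil_log n \<delta>"
      using decay[of "g - 1"] g(2) num_levels_posD(2)[OF K] by simp
    \<comment> \<open>With \<open>c = ceil_log n \<delta>\<close> positive,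
      \<open>g - 1 = 4 * c - 1\<close> exceeds \<open>c\<close>.\<close>
    also have "\<dots> < (1 + \<delta>) ^ (g - 1)"
      using num_levels_posD(1)[OF K] \<delta>_pos g(1) by (intro power_strict_increasing) auto
    finally show False by simp
  qed
qed


subsection \<open>Preservation by the update processes\<close>

text \<open>During insertions Invariant 2 always holds and Invariant 1 is settled below the visited
  level; during deletions Invariant 1 always holds and no true desire level is below the visited
  one. A stored desire level may be stale while its recomputation is pending, but a stored
  \<open>Some l\<close> must be true even then, since that vertex may move at any moment.\<close>

definition level_inv :: "config \<Rightarrow> bool" where
  "level_inv s \<longleftrightarrow> graph s \<subseteq> all_edges n \<and> (\<forall>v<n. level s v < num_levels n \<delta>) \<and>
     (\<forall>v. task s v \<noteq> Idle \<longrightarrow> v < n \<and> (\<exists>b l. phase s = Visit b l)) \<and>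
     (case phase s of
        Desires (kd, B) \<Rightarrow>
          kd = Deletion \<and> (\<forall>v<n. inv1 s v \<and> (v \<notin> recompute s \<longrightarrow> desire s v = true_desire s v))
      | Visit (Insertion, B) l \<Rightarrow>
          recompute s = {} \<and>
          (\<forall>v<n. inv2 s v \<and> (level s v < l \<longrightarrow> inv1 s v) \<and>
            (task s v \<noteq> Idle \<longrightarrow> must_move n \<delta> lam Insertion l s v))
      | Visit (Deletion, B) l \<Rightarrow>
          (\<forall>v<n. inv1 s v \<and> (v \<notin> recompute s \<longrightarrow> desire s v = true_desire s v) \<and>
            (\<forall>d. true_desire s v = Some d \<longrightarrow> l \<le> d) \<and>
            (desire s v = Some l \<longrightarrow> true_desire s v = Some l) \<and>
            (task s v \<noteq> Idle \<longrightarrow> desire s v = Some l))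
      | Edges (kd, B) \<Rightarrow> B \<subseteq> all_edges n \<and> recompute s = {} \<and> (\<forall>v<n. inv1 s v \<and> inv2 s v)
      | _ \<Rightarrow> recompute s = {} \<and> (\<forall>v<n. inv1 s v \<and> inv2 s v))"

lemma initial_level_inv: "initial n \<delta> lam s \<Longrightarrow> level_inv s"
  unfolding initial_def level_inv_def by simp

text \<open>The top level is in group \<open>ceil_log n \<delta>\<close>, whose bound is at least
  \<open>n\<close>. Hence no insertion pushes a vertex out of the structure.\<close>

lemma inv1_at_top:
  assumes "E \<subseteq> all_edges n" and "Suc l = num_levels n \<delta>"
  shows "inv1_at n \<delta> lam E lev v l"
proof -
  let ?c = "ceil_log n \<delta>"
  have K: "0 < num_levels n \<delta>" using assms(2) by simp
  have "0 < group_size n \<delta>" using num_levels_posD(1)[OF K] unfolding group_size_def by simp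
  moreover have "Suc l = ?c * group_size n \<delta> + group_size n \<delta>"
    using assms(2) unfolding num_levels_def by simp
  ultimately obtain r where "l = ?c * group_size n \<delta> + r" "r < group_size n \<delta>"
    by (metis add_Suc_right add_left_cancel lessI nat.inject not0_implies_Suc not_gr_zero)
  then have g: "group_of n \<delta> l = ?c" unfolding group_of_def by simp
  have "real (card (nbrs_from E lev v l)) \<le> real n"
    using card_mono[OF _ nbrs_from_subset[OF assms(1)]] by fastforce
  also have "\<dots> \<le> (1 + \<delta>) ^ ?c" by (rule num_levels_posD(2)[OF K])
  also have "\<dots> \<le> (2 + 3 / lam) * (1 + \<delta>) ^ ?c"
    by (rule scaled_power_ge)
  finally show ?thesis unfolding inv1_at_def g by simp
qed

text \<open>Only the set of vertices at levels from \<open>Suc l\<close> on changes, and it gains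
  \<open>v\<close>. So Invariant 1 up to level \<open>l\<close> is untouched, Invariant 2 is only
  helped, and \<open>v\<close> satisfies it at \<open>Suc l\<close> because it violated Invariant 1
  at \<open>l\<close>.\<close>

lemma level_inv_insertion_move:
  assumes inv: "level_inv s" and ph: "phase s = Visit (Insertion, B) l" and v: "task s v \<noteq> Idle"
  shows "level_inv (move Insertion l v s)"
proof -
  let ?lev = "(level s)(v := Suc l)"
  have E: "graph s \<subseteq> all_edges n" using inv unfolding level_inv_def by blast
  have lv: "level s v = l" and not1: "\<not> inv1_at n \<delta> lam (graph s) (level s) v l" and "v < n"
    using inv ph v unfolding level_inv_def by auto
  have same: "nbrs_from (graph s) ?lev w j = nbrs_from (graph s) (level s) w j" if "j \<noteq> Suc l" for w j
    using that lv unfolding nbrs_from_def by auto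
  have sub: "nbrs_from (graph s) (level s) w j \<subseteq> nbrs_from (graph s) ?lev w j" for w j
    using lv unfolding nbrs_from_def by auto
  have "Suc l \<noteq> num_levels n \<delta>" using inv1_at_top[OF E] not1 by blast
  moreover have "l < num_levels n \<delta>" using inv lv \<open>v < n\<close> unfolding level_inv_def by blast
  ultimately have "Suc l < num_levels n \<delta>" by simp
  moreover have "inv2_at n \<delta> (graph s) ?lev w (?lev w)" if "w < n" for w
  proof (rule inv2_at_subset[OF E sub])
    show "inv2_at n \<delta> (graph s) (level s) w (?lev w)"
      using not_inv1_at_imp_inv2_at_Suc[OF not1] inv ph that unfolding level_inv_def by auto
  qed
  moreover have "inv1_at n \<delta> lam (graph s) ?lev w j \<longleftrightarrow> inv1_at n \<delta> lam (graph s) (level s) w j"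
    if "j \<le> l" for w j
    using same[of j w] that unfolding inv1_at_def by simp
  ultimately show ?thesis
    using inv ph unfolding level_inv_def by auto
qed

text \<open>The move only affects \<open>Z\<^sub>j\<close> for \<open>j > l\<close>, i.e. Invariant 2 at levels above \<open>l + 1\<close>.\<close>

lemma level_inv_deletion_move:
  assumes inv: "level_inv s" and ph: "phase s = Visit (Deletion, B) l" and v: "task s v \<noteq> Idle"
  shows "level_inv (move Deletion l v s)"
proof -
  let ?s = "move Deletion l v s"
  let ?lev = "(level s)(v := l)"
  let ?inv2 = "inv2_at n \<delta> (graph s) (level s)" and ?inv2' = "inv2_at n \<delta> (graph s) ?lev"
  have E: "graph s \<subseteq> all_edges n" using inv unfolding level_inv_def by blast
  have "v < n" and tv: "true_desire s v = Some l"
    using inv ph v unfolding level_inv_def by auto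
  have lv: "l < level s v" "?inv2 v l" "\<not> ?inv2 v (Suc l)"
    using tv unfolding desire_level_eq_Some[OF E] by auto
  have sub: "nbrs_from (graph s) ?lev w j \<subseteq> nbrs_from (graph s) (level s) w j" for w j
    using lv unfolding nbrs_from_def by auto
  have same: "nbrs_from (graph s) ?lev w j = nbrs_from (graph s) (level s) w j"
    if "j \<le> l \<or> {v, w} \<notin> graph s" for w j
    using that lv unfolding nbrs_from_def by (auto simp: insert_commute)
  have loop: "{v, v} \<notin> graph s" using E all_edges_iff by blast
  have inv2_same: "?inv2' w j \<longleftrightarrow> ?inv2 w j" if "j \<le> Suc l \<or> {v, w} \<notin> graph s" for w j
  proof -
    have "j - 1 \<le> l \<or> {v, w} \<notin> graph s" using that by auto
    then show ?thesis using same[of "j - 1" w] unfolding inv2_at_def by simp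
  qed
  have inv2_down: "?inv2 w j" if "?inv2' w j" for w j
    using inv2_at_subset[OF E sub that] .
  have v_ok: "true_desire ?s v = None"
    using lv(2) inv2_same[of l v] by (simp add: desire_level_eq_None)
  have others: "(w \<notin> recompute ?s \<longrightarrow> desire s w = true_desire ?s w) \<and>
      (\<forall>d. true_desire ?s w = Some d \<longrightarrow> l \<le> d) \<and>
      (desire s w = Some l \<longrightarrow> true_desire ?s w = Some l)"
    if w: "w < n" "w \<noteq> v" for w
  proof (intro conjI impI allI)
    have old: "w \<notin> recompute s \<longrightarrow> desire s w = true_desire s w"
      "\<forall>d. true_desire s w = Some d \<longrightarrow> l \<le> d"
      "desire s w = Some l \<longrightarrow> true_desire s w = Some l"
      using inv ph w unfolding level_inv_def by auto
    \<comment> \<open>All neighbours above \<open>l\<close> are queued for recomputation. For the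
      remaining \<open>w\<close>, Invariant 2 is unchanged up to the own level, which determines the
      desire level.\<close>
    show "desire s w = true_desire ?s w" if "w \<notin> recompute ?s"
    proof -
      from that have rec: "w \<notin> recompute s" and *: "{v, w} \<notin> graph s \<or> level s w \<le> l" by auto
      have "?inv2' w j \<longleftrightarrow> ?inv2 w j" if "j \<le> level s w" for j
        using inv2_same[of j w] * that by auto
      then have "d < level s w \<Longrightarrow> ?inv2' w d \<longleftrightarrow> ?inv2 w d"
        "d < level s w \<Longrightarrow> ?inv2' w (Suc d) \<longleftrightarrow> ?inv2 w (Suc d)" for d
        by simp_all
      then have "true_desire ?s w = Some d \<longleftrightarrow> true_desire s w = Some d" for d
        using w(2) by (auto simp: desire_level_eq_Some[OF E])
      then have "true_desire ?s w = true_desire s w" by (metis not_None_eq)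
      with old(1) rec show ?thesis by simp
    qed
    \<comment> \<open>A desire level \<open>d < l\<close> depends on the levels \<open>d\<close> and
      \<open>Suc d\<close>, both unaffected, so it would have existed before the move.\<close>
    show "l \<le> d" if "true_desire ?s w = Some d" for d
    proof (rule ccontr)
      assume "\<not> l \<le> d"
      moreover from this have "true_desire s w = Some d"
        using that w(2) inv2_same[of d w] inv2_same[of "Suc d" w]
        by (simp add: desire_level_eq_Some[OF E])
      ultimately show False using old(2) by blast
    qed
    show "true_desire ?s w = Some l" if "desire s w = Some l"
      using old(3) that w(2) inv2_same[of l w] inv2_same[of "Suc l" w]
      by (simp add: desire_level_eq_Some[OF E])
  qed
  have inv1_new: "inv1 ?s w" if "w < n" for w
  proof -
    have "inv1_at n \<delta> lam (graph s) ?lev w (?lev w)"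
    proof (rule inv1_at_subset[OF E sub])
      \<comment> \<open>For \<open>v\<close> itself, maximality of the desire level means that
        Invariant 2 fails at \<open>Suc l\<close>, which yields Invariant 1 at
        \<open>l\<close>.\<close>
      show "inv1_at n \<delta> lam (graph s) (level s) w (?lev w)"
        using not_inv2_at_Suc_imp_inv1_at[OF lv(3)] inv ph that unfolding level_inv_def by auto
    qed
    then show ?thesis by simp
  qed
  have "\<forall>w<n. inv1 ?s w \<and> (w \<notin> recompute ?s \<longrightarrow> desire ?s w = true_desire ?s w) \<and>
      (\<forall>d. true_desire ?s w = Some d \<longrightarrow> l \<le> d) \<and>
      (desire ?s w = Some l \<longrightarrow> true_desire ?s w = Some l) \<and>
      (task ?s w \<noteq> Idle \<longrightarrow> desire ?s w = Some l)"
  proof (intro allI impI)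
    fix w assume "w < n"
    show "inv1 ?s w \<and> (w \<notin> recompute ?s \<longrightarrow> desire ?s w = true_desire ?s w) \<and>
      (\<forall>d. true_desire ?s w = Some d \<longrightarrow> l \<le> d) \<and>
      (desire ?s w = Some l \<longrightarrow> true_desire ?s w = Some l) \<and>
      (task ?s w \<noteq> Idle \<longrightarrow> desire ?s w = Some l)"
    proof (cases "w = v")
      case True
      then show ?thesis using inv1_new[OF \<open>w < n\<close>] unfolding True v_ok by simp
    next
      case False
      then have "desire ?s w = desire s w" "task ?s w = task s w" by simp_all
      moreover have "task s w \<noteq> Idle \<longrightarrow> desire s w = Some l"
        using inv ph \<open>w < n\<close> unfolding level_inv_def by auto
      ultimately show ?thesis
        using inv1_new[OF \<open>w < n\<close>] others[OF \<open>w < n\<close> False] by metis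
    qed
  qed
  moreover have "l < num_levels n \<delta>"
    using inv lv(1) \<open>v < n\<close> unfolding level_inv_def by (meson less_trans)
  then have "graph ?s \<subseteq> all_edges n" "\<forall>w<n. level ?s w < num_levels n \<delta>"
    "\<forall>w. task ?s w \<noteq> Idle \<longrightarrow> w < n \<and> (\<exists>b l. phase ?s = Visit b l)"
    using inv unfolding level_inv_def by auto
  moreover have "phase ?s = Visit (Deletion, B) l" using ph by simp
  ultimately show ?thesis
    unfolding level_inv_def by (simp only: phase.case prod.case kind.case)
qed

lemma level_inv_update_step:
  assumes "update_step n \<delta> lam pick s s'" and "level_inv s"
  shows "level_inv s'"
  using assms
proof cases
  case (insert_edges B)
  have E: "graph s \<union> B \<subseteq> all_edges n"
    using assms(2) insert_edges unfolding level_inv_def by auto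
  \<comment> \<open>New edges only help Invariant 2; Invariant 1 is now demanded below level 0 only,
    that is, nowhere.\<close>
  have "inv2_at n \<delta> (graph s \<union> B) (level s) v l" if "inv2_at n \<delta> (graph s) (level s) v l" for v l
    using that by (rule inv2_at_subset[OF E, rotated]) (auto simp: nbrs_from_def)
  then show ?thesis
    using assms(2) insert_edges E unfolding level_inv_def by auto
next
  case (delete_edges B)
  have E: "graph s \<subseteq> all_edges n"
    using assms(2) unfolding level_inv_def by auto
  have "inv1_at n \<delta> lam (graph s - B) (level s) v l" if "inv1_at n \<delta> lam (graph s) (level s) v l" for v l
    using that by (rule inv1_at_subset[OF E, rotated]) (auto simp: nbrs_from_def)
  then show ?thesis
    using assms(2) delete_edges E unfolding level_inv_def by auto
next
  case (compute_desire b l v)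
  obtain kd B where "b = (kd, B)" by fastforce
  then show ?thesis
    using assms(2) compute_desire unfolding level_inv_def by (cases kd) auto
next
  case (desires_done b)
  obtain kd B where "b = (kd, B)" by fastforce
  then show ?thesis
    using assms(2) desires_done unfolding level_inv_def by (cases kd) auto
next
  case (begin_mark kd B l v)
  then show ?thesis
    using assms(2) unfolding level_inv_def by (cases kd) auto
next
  case (skip_mark kd B l v)
  then show ?thesis
    using assms(2) unfolding level_inv_def by (cases kd) auto
next
  case (inspect kd B l v)
  then show ?thesis
    using assms(2) unfolding level_inv_def by (cases kd) auto
next
  case (union kd B l v)
  then show ?thesis
    using assms(2) unfolding level_inv_def by (cases kd) auto
next
  case (write_descriptor kd B l v)
  then show ?thesis
    using assms(2) unfolding level_inv_def by (cases kd) auto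
next
  case (next_level kd B l)
  show ?thesis
  proof (cases kd)
    case Insertion
    have "inv1 s v" if "v < n" "level s v < Suc l" for v
      using that assms(2) next_level Insertion unfolding level_inv_def
      by (cases "level s v = l") auto
    then show ?thesis
      using assms(2) next_level Insertion unfolding level_inv_def by auto
  next
    case Deletion
    have E: "graph s \<subseteq> all_edges n"
      using assms(2) unfolding level_inv_def by auto
    \<comment> \<open>With nothing left to recompute, the stored desire levels are the true ones,
      and none of them is \<open>l\<close>.\<close>
    have *: "Suc l \<le> d" if "v < n" "true_desire s v = Some d" for v d
    proof -
      have "l \<le> d" "desire s v = true_desire s v" "desire s v \<noteq> Some l"
        using that assms(2) next_level Deletion unfolding level_inv_def by auto
      then show ?thesis using that(2) by (cases "d = l") auto
    qed
    \<comment> \<open>After the top level, a remaining desire level would be at least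
      \<open>num_levels n \<delta>\<close> and yet below the level of \<open>v\<close>.\<close>
    have "inv2 s v" if "v < n" "num_levels n \<delta> \<le> Suc l" for v
    proof (rule ccontr)
      assume "\<not> inv2 s v"
      then obtain d where d: "true_desire s v = Some d"
        using desire_level_eq_None by blast
      then have "d < level s v" by (simp add: desire_level_eq_Some[OF E])
      moreover have "level s v < num_levels n \<delta>"
        using assms(2) that unfolding level_inv_def by blast
      ultimately show False using *[OF that(1) d] that(2) by simp
    qed
    then show ?thesis
      using assms(2) next_level Deletion * unfolding level_inv_def by auto
  qed
next
  case (change_level kd B l v)
  then show ?thesis
    using assms(2) level_inv_insertion_move level_inv_deletion_move by (cases kd) auto
qed (auto simp: level_inv_def)

lemma level_inv_compress_step: "compress_step s s' \<Longrightarrow> level_inv s \<Longrightarrow> level_inv s'"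
  by (auto elim!: compress_step.cases simp: level_inv_def split: phase.splits prod.splits kind.splits)

end


section \<open>Marks and dependency DAGs\<close>

lemma with_parent_eq_UNMARKED [simp]: "with_parent p d = UNMARKED \<longleftrightarrow> d = UNMARKED"
  by (cases d) auto

lemma cur_desc_redirect:
  "cur_desc (redirect u p s) = (cur_desc s)(u := with_parent p (cur_desc s u))"
  unfolding cur_desc_def redirect_def by (auto split: option.split)

lemma marked_redirect [simp]: "marked (redirect u p s) = marked s"
  unfolding marked_def redirect_def by (auto split: option.split)

lemma marked_link [simp]: "marked (link pick r1 r2 s) = marked s"
  unfolding link_def by simp

lemma new_desc_redirect_eq_None [simp]: "new_desc (redirect u p s) v = None \<longleftrightarrow> new_desc s v = None"
  unfolding redirect_def by (auto split: option.split)

lemma root_of_markedI: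
  assumes "(u, r) \<in> (parent_rel s)\<^sup>*" and "u \<noteq> r" and "\<forall>(x, p)\<in>parent_rel s. marked s p"
  shows "marked s r"
  using assms by (auto elim: rtranclE)

text \<open>The phases from the end of the visits to the next batch, in which levels no longer
  change.\<close>

definition late :: "config \<Rightarrow> bool" where
  "late s \<longleftrightarrow> phase s \<in> {Between, Unmark_Roots, Unmark_Rest}"

text \<open>\<open>Bt v l\<close> stands for: \<open>l\<close> is the level of \<open>v\<close> at some time between two batches.\<close>

locale mark_inv =
  fixes n :: nat and Bt :: "nat \<Rightarrow> nat \<Rightarrow> bool" and s :: config
  assumes task_range: "task s v \<noteq> Idle \<Longrightarrow> v < n \<and> (\<exists>b l. phase s = Visit b l)"
    and marked_range: "marked s v \<Longrightarrow> v < n \<and> phase s \<noteq> Between"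
    and new_desc_iff: "new_desc s v = None \<longleftrightarrow> (\<forall>A W. task s v \<noteq> Marking A W)"
    and new_desc_unmarked: "new_desc s v \<noteq> None \<Longrightarrow> \<not> marked s v \<and> cur_desc s v \<noteq> UNMARKED"
    and union_marked: "task s v = Marking A W \<Longrightarrow> w \<in> W \<Longrightarrow> marked s w"
    and moving_marked: "task s v = Moving \<Longrightarrow> marked s v"
    and old_level: "cur_desc s v = Marked q ol \<Longrightarrow> Bt v ol"
    and unmarked_level: "\<not> late s \<Longrightarrow> \<not> marked s v \<Longrightarrow> Bt v (level s v)"
    and parent_marked: "\<not> late s \<Longrightarrow> (v, w) \<in> parent_rel s \<Longrightarrow> marked s w"

lemmas mark_invD = mark_inv.task_range mark_inv.marked_range mark_inv.new_desc_iff
  mark_inv.new_desc_unmarked mark_inv.union_marked mark_inv.moving_marked mark_inv.old_level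
  mark_inv.unmarked_level mark_inv.parent_marked

lemma initial_mark_inv: "initial n \<delta> lam s \<Longrightarrow> mark_inv n Bt s"
  by (rule mark_inv.intro) (auto simp: initial_def marked_def cur_desc_def late_def)

lemma mark_inv_desc_array:
  assumes "mark_inv n Bt s" and "marked s v"
  shows "cur_desc s v = desc_array s v"
  using mark_inv.new_desc_unmarked[OF assms(1), of v] assms(2)
  unfolding cur_desc_def by (auto split: option.split)

text \<open>A redirection creates no parent other than \<open>r\<close> and keeps
  \<open>old_level\<close>, so only the mark of \<open>r\<close> has to be checked.\<close>

lemma mark_inv_redirect:
  assumes inv: "mark_inv n Bt s" and r: "\<not> late s \<Longrightarrow> marked s r"
  shows "mark_inv n Bt (redirect u r s)"
proof -
  note D = mark_invD[OF inv]
  have late: "late (redirect u r s) = late s" by (simp add: late_def)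
  have rel: "parent_rel (redirect u r s) \<subseteq> parent_rel s \<union> {(u, r)}"
    unfolding parent_rel_def cur_desc_redirect
    by (cases "cur_desc s u") (auto split: if_splits)
  show ?thesis
  proof (rule mark_inv.intro, unfold late marked_redirect redirect_simps new_desc_redirect_eq_None)
    show "\<not> marked s v \<and> cur_desc (redirect u r s) v \<noteq> UNMARKED" if "new_desc s v \<noteq> None" for v
      using D(4)[OF that] unfolding cur_desc_redirect by auto
    show "Bt v ol" if "cur_desc (redirect u r s) v = Marked q ol" for v q ol
      using that D(7) unfolding cur_desc_redirect
      by (cases "cur_desc s u") (auto split: if_splits)
    show "marked s p" if "\<not> late s" "(x, p) \<in> parent_rel (redirect u r s)" for x p
      using that D(9)[of x p] r rel by auto
  qed (fact D)+
qed

lemma mark_inv_compress_step: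
  assumes "compress_step s s'" and "mark_inv n Bt s"
  shows "mark_inv n Bt s'"
  using assms(1)
proof cases
  case (1 u p r)
  have "marked s r" if "\<not> late s"
  proof (rule root_of_markedI)
    show "(u, r) \<in> (parent_rel s)\<^sup>*" using 1 unfolding root_of_def by blast
    \<comment> \<open>\<open>u\<close> has a parent and so is no root; hence \<open>r\<close> is the
      parent in the last edge of a nonempty path.\<close>
    show "u \<noteq> r" using 1 unfolding root_of_def is_root_def parent_rel_def by auto
    show "\<forall>(x, p)\<in>parent_rel s. marked s p"
      using mark_inv.parent_marked[OF assms(2) that] by blast
  qed
  then show ?thesis using mark_inv_redirect[OF assms(2)] 1(1) by blast
qed

text \<open>The root of the merged DAG is marked: it has the marked vertex \<open>w\<close> below it.\<close>

lemma mark_inv_link: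
  assumes inv: "mark_inv n Bt s" and w: "marked s w"
    and r: "root_of s v r1" "root_of s w r2"
    and first: "root_marked_first s" "root_marked_first (link pick r1 r2 s)"
  shows "mark_inv n Bt (link pick r1 r2 s)"
proof -
  consider "r1 = r2" | "r1 \<noteq> r2" "pick s r1 r2 = r1" | "r1 \<noteq> r2" "pick s r1 r2 \<noteq> r1" by blast
  then show ?thesis
  proof cases
    case 2
    let ?s = "redirect r2 r1 s"
    have eq: "link pick r1 r2 s = ?s" using 2 unfolding link_def by simp
    have r2: "\<exists>ol. cur_desc s r2 = Marked I_AM_ROOT ol" and r1: "\<exists>ol. cur_desc s r1 = Marked I_AM_ROOT ol"
      using r unfolding root_of_def is_root_def by auto
    have "parent_rel s \<subseteq> parent_rel ?s" and new: "(r2, r1) \<in> parent_rel ?s"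
      using r2 unfolding parent_rel_def cur_desc_redirect by auto
    then have "(w, r2) \<in> (parent_rel ?s)\<^sup>*"
      using r(2) rtrancl_mono unfolding root_of_def by blast
    \<comment> \<open>\<open>r1\<close> stays a root, and the marked \<open>w\<close> now reaches it
      through \<open>r2\<close>; so the condition on the new state marks \<open>r1\<close>.\<close>
    then have "root_of ?s w r1"
      using new r1 2 unfolding root_of_def is_root_def cur_desc_redirect by auto
    then have "marked s r1"
      using first(2) w unfolding eq root_marked_first_def by auto
    then show ?thesis unfolding eq using mark_inv_redirect[OF inv] by blast
  next
    case 3
    \<comment> \<open>Here the surviving root is already above \<open>w\<close>, so the condition on
      the old state suffices.\<close>
    have "marked s r2" using first(1) w r(2) unfolding root_marked_first_def by blast
    then show ?thesis using mark_inv_redirect[OF inv] 3 unfolding link_def by simp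
  qed (use inv in \<open>simp add: link_def\<close>)
qed

section \<open>Preservation of the marking invariant by update steps\<close>

lemma same_descriptors:
  assumes "new_desc s' = new_desc s" and "desc_array s' = desc_array s"
  shows "cur_desc s' = cur_desc s" and "marked s' = marked s" and "parent_rel s' = parent_rel s"
    and "root_of s' = root_of s"
proof -
  show cur: "cur_desc s' = cur_desc s" unfolding cur_desc_def assms ..
  show "marked s' = marked s" unfolding marked_def assms ..
  show rel: "parent_rel s' = parent_rel s" unfolding parent_rel_def cur ..
  show "root_of s' = root_of s" by (simp add: root_of_def is_root_def rel cur fun_eq_iff)
qed

lemma mark_inv_change_phase:
  assumes "mark_inv n Bt s"
    and "new_desc s' = new_desc s" and "desc_array s' = desc_array s"
    and "task s' = task s" and "level s' = level s"
    and "\<exists>v. task s v \<noteq> Idle \<Longrightarrow> \<exists>b l. phase s' = Visit b l"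
    and "phase s' = Between \<Longrightarrow> \<forall>v. \<not> marked s v"
    and "\<not> late s' \<Longrightarrow> \<not> late s"
  shows "mark_inv n Bt s'"
proof (rule mark_inv.intro, unfold assms(2-5) same_descriptors[OF assms(2,3)])
  show "v < n \<and> (\<exists>b l. phase s' = Visit b l)" if "task s v \<noteq> Idle" for v
    using mark_invD(1)[OF assms(1)] assms(6) that by blast
  show "v < n \<and> phase s' \<noteq> Between" if "marked s v" for v
    using mark_invD(2)[OF assms(1)] assms(7) that by blast
qed (fact mark_invD[OF assms(1)] mark_invD(8,9)[OF assms(1) assms(8)])+

text \<open>Levels of marked vertices are left free, which covers the actual move: a moving vertex
  is marked.\<close>

lemma mark_inv_change_task:
  assumes "mark_inv n Bt s"
    and "new_desc s' = new_desc s" and "desc_array s' = desc_array s"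
    and "task s' = (task s)(v := x)" and "phase s' = phase s"
    and "task s v \<noteq> Idle \<or> v < n \<and> (\<exists>b l. phase s = Visit b l)"
    and "\<forall>w. \<not> marked s w \<longrightarrow> level s' w = level s w"
    and "(\<exists>A W. x = Marking A W) \<longleftrightarrow> (\<exists>A W. task s v = Marking A W)"
    and "\<forall>A W. x = Marking A W \<longrightarrow> (\<forall>w\<in>W. marked s w)"
    and "x = Moving \<longrightarrow> marked s v"
  shows "mark_inv n Bt s'"
proof -
  have late: "late s' = late s" using assms(5) unfolding late_def by simp
  note D = mark_invD[OF assms(1)]
  show ?thesis
  proof (rule mark_inv.intro, unfold assms(2-5) same_descriptors[OF assms(2,3)] late)
    show "w < n \<and> (\<exists>b l. phase s = Visit b l)" if "((task s)(v := x)) w \<noteq> Idle" for w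
      using D(1)[of w] assms(6) that by (cases "w = v") auto
    show "new_desc s w = None \<longleftrightarrow> (\<forall>A W. ((task s)(v := x)) w \<noteq> Marking A W)" for w
      using D(3)[of w] assms(8) by (cases "w = v") auto
    show "marked s u" if "((task s)(v := x)) w = Marking A W" "u \<in> W" for w A W u
      using D(5)[of w A W u] assms(9) that by (cases "w = v") auto
    show "marked s w" if "((task s)(v := x)) w = Moving" for w
      using D(6)[of w] assms(10) that by (cases "w = v") auto
    show "Bt w (level s' w)" if "\<not> late s" "\<not> marked s w" for w
      using D(8)[of w] assms(7) that by simp
  qed (fact D)+
qed

text \<open>No vertex is being processed any more, so no descriptor is under construction; the
  clauses on unmarked levels and marked parents are demanded only before
  \<open>late\<close>.\<close>

lemma mark_inv_unmark:
  assumes inv: "mark_inv n Bt s" and late: "phase s = Unmark_Roots \<or> phase s = Unmark_Rest"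
  shows "mark_inv n Bt (s\<lparr>desc_array := (desc_array s)(v := UNMARKED)\<rparr>)" (is "mark_inv n Bt ?s")
proof -
  note D = mark_invD[OF inv]
  have idle: "task s w = Idle" for w using D(1)[of w] late by (cases "task s w = Idle") auto
  then have none: "new_desc s w = None" for w using D(3) by simp
  then have cur: "cur_desc ?s w = (if w = v then UNMARKED else cur_desc s w)" for w
    unfolding cur_desc_def by simp
  show ?thesis
  proof (rule mark_inv.intro)
    show "w < n \<and> phase ?s \<noteq> Between" if "marked ?s w" for w
      using that D(2)[of w] unfolding marked_def by (auto split: if_splits)
    show "Bt w ol" if "cur_desc ?s w = Marked q ol" for w q ol
      using that D(7) unfolding cur by (auto split: if_splits)
  qed (use idle none late in \<open>auto simp: late_def\<close>)
qed

lemma mark_inv_update_step: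
  assumes step: "update_step n \<delta> lam pick s s'" and inv: "mark_inv n Bt s"
    and first: "root_marked_first s" "root_marked_first s'"
    and Bt: "phase s = Between \<Longrightarrow> \<forall>v. Bt v (level s v)"
  shows "mark_inv n Bt s'"
proof -
  note D = mark_invD[OF inv]
  from step show ?thesis
  proof cases
    case (start_batch B kd)
    \<comment> \<open>The clauses guarded by \<open>late\<close> come into force here: no vertex is
      marked, there are no parents, and all levels are levels between batches.\<close>
    have idle: "task s v = Idle" for v using D(1)[of v] start_batch(2) by auto
    then have none: "new_desc s v = None" for v using D(3) by simp
    have unmarked: "\<not> marked s v" for v using D(2) start_batch(2) by blast
    then have cur: "cur_desc s v = UNMARKED" for v
      using none unfolding cur_desc_def marked_def by simp
    then have "parent_rel s = {}" unfolding parent_rel_def by simp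
    moreover have same: "new_desc s' = new_desc s" "desc_array s' = desc_array s" "task s' = task s"
      "level s' = level s"
      unfolding start_batch(1) by simp_all
    ultimately show ?thesis
      using Bt[OF start_batch(2)]
      by (intro mark_inv.intro)
        (simp_all add: same_descriptors[OF same(1,2)] idle none unmarked cur)
  next
    case (next_level kd B l)
    have "task s v = Idle" for v using next_level(3) D(1)[of v] by blast
    then show ?thesis
      using next_level by (intro mark_inv_change_phase[OF inv]) (auto simp: late_def split: if_splits)
  next
    case (begin_mark kd B l v)
    have cur: "cur_desc s' = (cur_desc s)(v := Marked I_AM_ROOT (level s v))"
      unfolding begin_mark(1) by (auto simp: cur_desc_def split: option.split)
    have rel: "parent_rel s' \<subseteq> parent_rel s" unfolding parent_rel_def cur by (auto split: if_splits)
    have upd: "marked s' = marked s" "phase s' = phase s" "level s' = level s"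
      "new_desc s' = (new_desc s)(v := Some (Marked I_AM_ROOT (level s v)))"
      "task s' = (task s)(v := Marking {..<n} {})"
      unfolding begin_mark(1) marked_def by simp_all
    have late: "late s' = late s" unfolding late_def upd ..
    \<comment> \<open>\<open>v\<close> is unmarked and so has not moved in this batch; the level
      recorded as \<open>old_level\<close> is one between batches.\<close>
    have Bt_v: "Bt v (level s v)" using begin_mark(2,6) D(8)[of v] unfolding late_def by auto
    show ?thesis
    proof (rule mark_inv.intro, unfold upd late)
      show "w < n \<and> (\<exists>b l. phase s = Visit b l)" if "((task s)(v := Marking {..<n} {})) w \<noteq> Idle" for w
        using D(1)[of w] begin_mark(2,3) that by (cases "w = v") auto
      show "((new_desc s)(v := Some (Marked I_AM_ROOT (level s v)))) w = None \<longleftrightarrow>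
          (\<forall>A W. ((task s)(v := Marking {..<n} {})) w \<noteq> Marking A W)" for w
        using D(3)[of w] by (cases "w = v") auto
      show "\<not> marked s w \<and> cur_desc s' w \<noteq> UNMARKED"
        if "((new_desc s)(v := Some (Marked I_AM_ROOT (level s v)))) w \<noteq> None" for w
        using D(4)[of w] begin_mark(6) that unfolding cur by (cases "w = v") auto
      show "marked s u" if "((task s)(v := Marking {..<n} {})) w = Marking A W" "u \<in> W" for w A W u
        using D(5)[of w A W u] that by (cases "w = v") auto
      show "marked s w" if "((task s)(v := Marking {..<n} {})) w = Moving" for w
        using D(6)[of w] that by (cases "w = v") auto
      show "Bt w ol" if "cur_desc s' w = Marked q ol" for w q ol
        using D(7)[of w q ol] Bt_v that unfolding cur by (cases "w = v") auto
      show "marked s p" if "\<not> late s" "(u, p) \<in> parent_rel s'" for u p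
        using D(9) rel that by blast
    qed (fact D)+
  next
    case (skip_mark kd B l v)
    then show ?thesis
      by (intro mark_inv_change_task[OF inv, where v = v and x = Moving]) auto
  next
    case (inspect kd B l v A W w W')
    have "trigger kd s v w \<Longrightarrow> marked s w" by (cases kd) auto
    then have "\<forall>w\<in>W'. marked s w"
      using inspect(5) D(5)[OF inspect(3)] by (auto split: if_splits)
    then show ?thesis
      using inspect(1-3)
      by (intro mark_inv_change_task[OF inv, where v = v and x = "Marking (A - {w}) W'"]) auto
  next
    case (union kd B l v W w r1 r2)
    let ?s = "link pick r1 r2 s"
    have W: "\<forall>w\<in>W. marked s w" using D(5)[OF union(3)] by blast
    \<comment> \<open>The condition on roots is given for the state after the whole step, which
      differs from \<open>?s\<close> in a task only.\<close>
    have "new_desc s' = new_desc ?s" "desc_array s' = desc_array ?s"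
      unfolding union(1) by simp_all
    then have "root_marked_first ?s"
      using first(2) same_descriptors unfolding root_marked_first_def by metis
    then have "mark_inv n Bt ?s"
      using mark_inv_link[OF inv _ union(5,6) first(1)] W union(4) by blast
    then show ?thesis
      using union(1,3) W
      by (elim mark_inv_change_task[where v = v and x = "Marking {} (W - {w})"]) auto
  next
    case (write_descriptor kd B l v d)
    have d: "cur_desc s v = d" using write_descriptor(4) unfolding cur_desc_def by simp
    have "d \<noteq> UNMARKED"
      using D(4)[of v] write_descriptor(4) d by simp
    then have marked: "marked s' = (\<lambda>w. marked s w \<or> w = v)"
      unfolding write_descriptor(1) marked_def by auto
    \<comment> \<open>\<open>cur_desc\<close> already shows the new descriptor, so publishing it
      changes marks but not the DAGs.\<close>
    have cur: "cur_desc s' = cur_desc s"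
      using d unfolding write_descriptor(1) by (auto simp: cur_desc_def split: option.split)
    have rel: "parent_rel s' = parent_rel s" unfolding parent_rel_def cur ..
    have upd: "phase s' = phase s" "level s' = level s" "task s' = (task s)(v := Moving)"
      "new_desc s' = (new_desc s)(v := None)"
      unfolding write_descriptor(1) by simp_all
    have late: "late s' = late s" unfolding late_def upd ..
    show ?thesis
    proof (rule mark_inv.intro, unfold cur rel marked upd late)
      show "w < n \<and> (\<exists>b l. phase s = Visit b l)" if "((task s)(v := Moving)) w \<noteq> Idle" for w
        using D(1)[of w] D(1)[of v] write_descriptor(3) that by (cases "w = v") auto
      show "w < n \<and> phase s \<noteq> Between" if "marked s w \<or> w = v" for w
        using D(2)[of w] D(1)[of v] write_descriptor(2,3) that by auto
      show "((new_desc s)(v := None)) w = None \<longleftrightarrow> (\<forall>A W. ((task s)(v := Moving)) w \<noteq> Marking A W)" for w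
        using D(3)[of w] by (cases "w = v") auto
      show "\<not> (marked s w \<or> w = v) \<and> cur_desc s w \<noteq> UNMARKED"
        if "((new_desc s)(v := None)) w \<noteq> None" for w
        using D(4)[of w] that by (cases "w = v") auto
      show "marked s u \<or> u = v" if "((task s)(v := Moving)) w = Marking A W" "u \<in> W" for w A W u
        using D(5)[of w A W u] that by (cases "w = v") auto
      show "marked s w \<or> w = v" if "((task s)(v := Moving)) w = Moving" for w
        using D(6)[of w] that by (cases "w = v") auto
      show "Bt w (level s w)" if "\<not> late s" "\<not> (marked s w \<or> w = v)" for w
        using D(8)[of w] that by simp
      show "marked s p \<or> p = v" if "\<not> late s" "(u, p) \<in> parent_rel s" for u p
        using D(9) that by blast
    qed (fact D)+
  next
    case (change_level kd B l v)
    have "marked s v" using D(6) change_level(3) .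
    then show ?thesis
      using change_level
      by (intro mark_inv_change_task[OF inv, where v = v and x = Idle]; cases kd) auto
  next
    case (unmark_root v ol)
    then show ?thesis using mark_inv_unmark[OF inv] by blast
  next
    case (unmark_rest v)
    then show ?thesis using mark_inv_unmark[OF inv] by blast
  qed (rule mark_inv_change_phase[OF inv];
      use D(1,2) in \<open>auto simp: late_def\<close>)+
qed


section \<open>Reads\<close>

text \<open>The guards express when \<open>l1\<close> has to be trusted: with an outdated
  \<open>b1\<close> the read will restart, and once the batch is late, \<open>l2\<close> will be a
  final level. In \<open>Step4\<close> with a marked \<open>d\<close>, the traversal cannot meet an
  unmarked descriptor under these guards.\<close>

fun read_inv :: "nat \<Rightarrow> real \<Rightarrow> (nat \<Rightarrow> nat \<Rightarrow> bool) \<Rightarrow> config \<Rightarrow> reader \<Rightarrow> bool" where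
  "read_inv n \<delta> Bt s Inactive \<longleftrightarrow> True"
| "read_inv n \<delta> Bt s (Step1 v) \<longleftrightarrow> v < n"
| "read_inv n \<delta> Bt s (Step2 v b1) \<longleftrightarrow> v < n \<and> b1 \<le> batch_number s"
| "read_inv n \<delta> Bt s (Step3 v b1 l1) \<longleftrightarrow> v < n \<and> b1 \<le> batch_number s \<and>
     (b1 = batch_number s \<and> \<not> late s \<and> \<not> marked s v \<longrightarrow> Bt v l1)"
| "read_inv n \<delta> Bt s (Step4 v b1 l1 d d') \<longleftrightarrow> v < n \<and> b1 \<le> batch_number s \<and>
     (if d = UNMARKED then d' = UNMARKED \<and> (b1 = batch_number s \<and> \<not> late s \<longrightarrow> Bt v l1)
      else Bt v (old_level d) \<and>
        (b1 = batch_number s \<and> \<not> late s \<longrightarrow>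
           d' \<noteq> UNMARKED \<and> (\<forall>p ol. d' = Marked (Parent p) ol \<longrightarrow> marked s p)))"
| "read_inv n \<delta> Bt s (Step5 v b1 l1 d st) \<longleftrightarrow> v < n \<and> b1 \<le> batch_number s \<and>
     (if st = DAG_MARKED then Bt v (old_level d)
      else b1 = batch_number s \<and> \<not> late s \<longrightarrow> Bt v l1)"
| "read_inv n \<delta> Bt s (Step6 v b1 l1 d st l2) \<longleftrightarrow> v < n \<and> b1 \<le> batch_number s \<and>
     (if st = DAG_MARKED then Bt v (old_level d)
      else b1 = batch_number s \<longrightarrow> Bt v l1 \<or> Bt v l2)"
| "read_inv n \<delta> Bt s (Returned v l k) \<longleftrightarrow> v < n \<and> Bt v l \<and> k = estimate n \<delta> l"

text \<open>The batch number only grows, so an outdated \<open>b1\<close> stays outdated; within a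
  batch, \<open>late\<close> is never left, and marks are not lost before it.\<close>

lemma read_inv_mono:
  assumes "read_inv n \<delta> Bt s r" and "batch_number s \<le> batch_number s'"
    and "batch_number s' = batch_number s \<Longrightarrow> \<not> late s' \<Longrightarrow>
      \<not> late s \<and> (\<forall>v. marked s v \<longrightarrow> marked s' v)"
  shows "read_inv n \<delta> Bt s' r"
  using assms by (cases r) (auto split: if_splits)

lemma read_inv_update_step:
  assumes "update_step n \<delta> lam pick s s'" and "read_inv n \<delta> Bt s r" and mark: "mark_inv n Bt s"
  shows "read_inv n \<delta> Bt s' r"
proof (rule read_inv_mono[OF assms(2)])
  show "batch_number s \<le> batch_number s'"
    using assms(1)
  proof cases
    case (change_level kd B l v)
    then show ?thesis by (cases kd) auto
  qed auto
  show "\<not> late s \<and> (\<forall>v. marked s v \<longrightarrow> marked s' v)"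
    if "batch_number s' = batch_number s" "\<not> late s'"
    using assms(1)
  proof cases
    case (union kd B l v W w r1 r2)
    have "marked s' = marked (link pick r1 r2 s)" unfolding union(1) marked_def by simp
    then show ?thesis using union by (simp add: late_def)
  next
    case (write_descriptor kd B l v d)
    then have "d \<noteq> UNMARKED"
      using mark_inv.new_desc_unmarked[OF mark, of v] unfolding cur_desc_def by simp
    then show ?thesis using write_descriptor by (auto simp: late_def marked_def)
  next
    case (change_level kd B l v)
    then show ?thesis by (cases kd) (auto simp: late_def marked_def)
  qed (use that in \<open>auto simp: late_def marked_def\<close>)
qed

lemma read_inv_compress_step:
  assumes "compress_step s s'" and "read_inv n \<delta> Bt s r"
  shows "read_inv n \<delta> Bt s' r"
  using assms(1)
proof cases
  case (1 u p r')
  show ?thesis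
    by (rule read_inv_mono[OF assms(2)]) (auto simp: 1 late_def)
qed

text \<open>At step 5 with an unmarked status, either the batch is late and \<open>l2\<close> is a
  final level, or the invariant already vouches for \<open>l1\<close>, or \<open>b1\<close> is
  outdated.\<close>

lemma read_inv_read_step:
  assumes step: "read_step n \<delta> s r r'" and inv: "read_inv n \<delta> Bt s r" and mark: "mark_inv n Bt s"
    and late: "late s \<Longrightarrow> \<forall>v. Bt v (level s v)"
  shows "read_inv n \<delta> Bt s r'"
proof -
  have unmarked: "Bt v (level s v)" if "\<not> late s" "\<not> marked s v" for v
    using that mark_inv.unmarked_level[OF mark] by blast
  have old: "Bt v (old_level (desc_array s v))" if "desc_array s v \<noteq> UNMARKED" for v
    using that mark_inv_desc_array[OF mark, of v] mark_inv.old_level[OF mark, of v]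
    unfolding marked_def by (cases "desc_array s v") auto
  have parent: "marked s p" if "\<not> late s" "desc_array s u = Marked (Parent p) ol" for u p ol
  proof -
    have "(u, p) \<in> parent_rel s"
      using that(2) mark_inv_desc_array[OF mark, of u] unfolding parent_rel_def marked_def by auto
    then show ?thesis using that(1) mark_inv.parent_marked[OF mark] by blast
  qed
  show ?thesis
    using step
  proof cases
    case (read3 v b1 l1)
    show ?thesis
    proof (cases "desc_array s v = UNMARKED")
      case True
      \<comment> \<open>Marks persist until the unmarking, so a vertex unmarked now was unmarked
        when \<open>l1\<close> was read.\<close>
      then show ?thesis using read3 inv by (auto simp: marked_def)
    next
      case False
      then show ?thesis using read3 inv old parent by auto
    qed
  next
    case (check_parent v b1 l1 d p ol)
    \<comment> \<open>The descriptor held by the reader may be an outdated copy, but its parent was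
      marked when it was read and stays marked until the unmarking.\<close>
    then show ?thesis
      using inv parent by (auto simp: marked_def split: if_splits)
  qed (use inv late unmarked in \<open>auto split: if_splits intro: dag_status.exhaust\<close>)
qed


section \<open>Executions\<close>

text \<open>Bounds the number of update steps until the end of a batch whose vertices have all moved.\<close>

definition unmark_measure :: "config \<Rightarrow> nat" where
  "unmark_measure s = card {v. marked s v} +
     (case phase s of Unmark_Roots \<Rightarrow> 2 | Unmark_Rest \<Rightarrow> 1 | _ \<Rightarrow> 0)"

text \<open>Each step clears a mark or closes a round of unmarking; the summands 2 and 1 count the
  rounds still to be closed.\<close>

lemma late_update_step:
  assumes step: "update_step n \<delta> lam pick s s'" and "late s" "phase s \<noteq> Between"
    and fin: "finite {v. marked s v}"
  shows "late s' \<and> level s' = level s \<and> unmark_measure s' < unmark_measure s"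
proof -
  have unmark: "card {w. marked (s\<lparr>desc_array := (desc_array s)(v := UNMARKED)\<rparr>) w} < card {w. marked s w}"
    if "desc_array s v \<noteq> UNMARKED" for v
    by (rule psubset_card_mono[OF fin]) (use that in \<open>auto simp: marked_def\<close>)
  have same: "marked (s\<lparr>phase := ph\<rparr>) = marked s" for ph
    unfolding marked_def by simp
  from step show ?thesis
  proof cases
    case (unmark_root v ol)
    then show ?thesis using unmark[of v] by (simp add: late_def unmark_measure_def)
  next
    case (unmark_rest v)
    then show ?thesis using unmark[of v] by (simp add: late_def unmark_measure_def marked_def)
  qed (use assms(2,3) in \<open>auto simp: late_def unmark_measure_def same\<close>)
qed

locale cplds_execution = level_structure +
  fixes pick :: "config \<Rightarrow> nat \<Rightarrow> nat \<Rightarrow> nat" and \<sigma> :: "nat \<Rightarrow> 'p execution_state"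
  assumes exec: "execution n \<delta> lam pick \<sigma>"
begin

abbreviation conf :: "nat \<Rightarrow> config" where
  "conf t \<equiv> fst (\<sigma> t)"

text \<open>The time may lie in the future: a level read during the unmarking is justified by the
  coming end of the batch.\<close>

definition between_level :: "nat \<Rightarrow> nat \<Rightarrow> bool" where
  "between_level v l \<longleftrightarrow> (\<exists>t. phase (conf t) = Between \<and> level (conf t) v = l)"

lemma initial_conf: "initial n \<delta> lam (conf 0)"
  using exec unfolding execution_def by blast

lemma root_marked_first: "root_marked_first (conf t)"
  using exec unfolding execution_def by blast

lemma system_step: "system_step n \<delta> lam pick (\<sigma> t) (\<sigma> (Suc t))"
  using exec unfolding execution_def by blast

lemma conf_step_cases:
  obtains "conf (Suc t) = conf t" | "update_step n \<delta> lam pick (conf t) (conf (Suc t))"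
  | "compress_step (conf t) (conf (Suc t))"
  using system_step[of t] by cases auto

lemma level_inv_conf: "level_inv (conf t)"
proof (induction t)
  case 0
  then show ?case using initial_level_inv initial_conf by blast
next
  case (Suc t)
  then show ?case
    by (cases rule: conf_step_cases[of t]) (auto intro: level_inv_update_step level_inv_compress_step)
qed

lemma mark_inv_conf: "mark_inv n between_level (conf t)"
proof (induction t)
  case 0
  then show ?case using initial_mark_inv initial_conf by blast
next
  case (Suc t)
  have "\<forall>v. between_level v (level (conf t) v)" if "phase (conf t) = Between"
    using that unfolding between_level_def by blast
  with Suc show ?case
    using mark_inv_update_step[OF _ Suc root_marked_first root_marked_first] mark_inv_compress_step
    by (cases rule: conf_step_cases[of t]) auto
qed

lemma finite_marked: "finite {v. marked (conf t) v}"
  by (rule finite_subset[of _ "{..<n}"]) (use mark_inv.marked_range[OF mark_inv_conf] in auto)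

text \<open>Progress promises an update step \<open>d\<close> transitions ahead. The inner induction
  on \<open>d\<close> passes over reads, stuttering and compressions, which keep the measure; an
  update step lowers it and invokes the outer induction.\<close>

lemma late_reaches_Between:
  "late (conf t) \<Longrightarrow> \<exists>t'. phase (conf t') = Between \<and> level (conf t') = level (conf t)"
proof (induction "unmark_measure (conf t)" arbitrary: t rule: less_induct)
  case less
  have "\<exists>t'. phase (conf t') = Between \<and> level (conf t') = level (conf u)"
    if "update_step n \<delta> lam pick (conf (u + d)) (conf (Suc (u + d)))" "late (conf u)"
      "phase (conf u) \<noteq> Between" "unmark_measure (conf u) = unmark_measure (conf t)" for u d
    using that
  proof (induction d arbitrary: u)
    case 0
    then show ?case
      using late_update_step[OF _ 0(2,3) finite_marked] less.hyps[of "Suc u"] by fastforce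
  next
    case (Suc d)
    show ?case
    proof (cases rule: conf_step_cases[of u])
      case 1
      then show ?thesis using Suc.IH[of "Suc u"] Suc.prems by simp
    next
      case 2
      then show ?thesis
        using late_update_step[OF 2 Suc.prems(2,3) finite_marked] less.hyps[of "Suc u"] Suc.prems(4)
        by fastforce
    next
      case 3
      then have "phase (conf (Suc u)) = phase (conf u)" "level (conf (Suc u)) = level (conf u)"
        "marked (conf (Suc u)) = marked (conf u)"
        by (auto elim: compress_step.cases)
      then show ?thesis
        using Suc.IH[of "Suc u"] Suc.prems by (simp add: late_def unmark_measure_def)
    qed
  qed
  moreover obtain t' where "t' \<ge> t" "update_step n \<delta> lam pick (conf t') (conf (Suc t'))"
    if "phase (conf t) \<noteq> Between"
    using exec unfolding execution_def by blast
  ultimately show ?case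
    using less.prems by (metis le_add_diff_inverse)
qed

lemma late_between_level: "late (conf t) \<Longrightarrow> between_level v (level (conf t) v)"
  unfolding between_level_def by (metis late_reaches_Between)

lemma read_inv_conf: "read_inv n \<delta> between_level (conf t) (snd (\<sigma> t) p)"
proof (induction t arbitrary: p)
  case 0
  have "snd (\<sigma> 0) p = Inactive" using exec unfolding execution_def by blast
  then show ?case by simp
next
  case (Suc t)
  from system_step[of t] show ?case
  proof cases
    case (update s s' R)
    then show ?thesis
      using read_inv_update_step[of n \<delta> lam pick s s' between_level "R p"] Suc[of p] mark_inv_conf[of t]
      by simp
  next
    case (compress s s' R)
    then show ?thesis
      using read_inv_compress_step[of s s' n \<delta> between_level "R p"] Suc[of p] by simp
  next
    case (read s R q r)
    then show ?thesis
      using read_inv_read_step[of n \<delta> s "R q" r between_level] Suc[of p] Suc[of q]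
        mark_inv_conf[of t] late_between_level[of t] by simp
  next
    case (stutter s R)
    then show ?thesis using Suc[of p] by simp
  qed
qed

lemma Between_approximation:
  assumes "phase (conf t) = Between" and "v < n"
  defines "k \<equiv> coreness n (graph (conf t)) v" and "e \<equiv> estimate n \<delta> (level (conf t) v)"
  shows "real k \<le> (2 + 3 / lam) * (1 + \<delta>) * e"
    and "1 \<le> k \<Longrightarrow> e \<le> (2 + 3 / lam) * (1 + \<delta>) * real k"
proof -
  have E: "graph (conf t) \<subseteq> all_edges n"
    and inv: "u < n \<Longrightarrow> level (conf t) u < num_levels n \<delta> \<and> inv1 (conf t) u \<and> inv2 (conf t) u" for u
    using level_inv_conf[of t] assms(1) unfolding level_inv_def by auto
  show "real k \<le> (2 + 3 / lam) * (1 + \<delta>) * e"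
    unfolding k_def e_def using inv by (intro coreness_le_estimate[OF E \<open>v < n\<close>]) blast
  have K: "0 < num_levels n \<delta>" using inv[OF \<open>v < n\<close>] by simp
  show "e \<le> (2 + 3 / lam) * (1 + \<delta>) * real k" if "1 \<le> k"
    using that inv unfolding k_def e_def by (intro estimate_le_coreness[OF E \<open>v < n\<close> K]) blast+
qed

end

theorem mainTheorem2:
  fixes n :: nat and \<delta> lam eps :: real
    and pick :: "config \<Rightarrow> nat \<Rightarrow> nat \<Rightarrow> nat"
    and \<sigma> :: "nat \<Rightarrow> 'p execution_state"
    and t v l :: nat and p :: 'p and k_hat :: real
  assumes "\<delta> > 0" and "lam > 0" and "2 + eps = (2 + 3 / lam) * (1 + \<delta>)"
    and "execution n \<delta> lam pick \<sigma>"
    and "snd (\<sigma> t) p = Returned v l k_hat"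
  shows "\<exists>t'. phase (fst (\<sigma> t')) = Between \<and>
           level (fst (\<sigma> t')) v = l \<and> k_hat = estimate n \<delta> l \<and>
           (let k = coreness n (graph (fst (\<sigma> t'))) v in
              k \<ge> 1 \<longrightarrow> real k / (2 + eps) \<le> k_hat \<and> k_hat \<le> (2 + eps) * real k)"
proof -
  interpret cplds_execution n \<delta> lam pick \<sigma>
    by unfold_locales (use assms in auto)
  have v: "v < n" and l: "between_level v l" and k: "k_hat = estimate n \<delta> l"
    using read_inv_conf[of t p] assms(5) by auto
  from l obtain t' where t': "phase (conf t') = Between" "level (conf t') v = l"
    unfolding between_level_def by blast
  have "0 < 2 + eps" using assms(1-3) by (simp add: add_pos_pos)
  then show ?thesis
    using t' k Between_approximation[OF t'(1) v] assms(3)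
    by (intro exI[of _ t']) (simp add: Let_def pos_divide_le_eq mult.commute)
qed

end
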